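(* For every $t>0$ there exist constants $C_1(t),C_2(t)>0$ depending only on $t$ such that the following holds. Let $N\ge2$ be an integer and let $f$ be a real-valued function which is $1$-periodic in each variable and belongs to $C^3([0,1]^3)$. Let $U_tf$ be the periodic wave snapshot of $f$ at time $t$, assume that $U_tf$ is not identically zero, and let $g_t(x)=(U_tf)(x/N)$, $x\in\mathbb{Z}_N^3$, be its discretization on $\mathbb{Z}_N^3$. Assume that $$N\|U_tf\|_{L^2([0,1]^3)}^2\ge 4C_3\|U_tf\|_{C^2([0,1]^3)}^2 .$$ Define $$A_t^{\mathrm{wave}}=2\,\frac{\left|\int_{[0,1]^3}(U_tf)(x)\,dx\right|}{\|U_tf\|_{L^2([0,1]^3)}},\quad B_t^{\mathrm{wave}}=C_1(t)\frac{\|f\|_{C^3([0,1]^3)}}{\|U_tf\|_{L^2([0,1]^3)}},\quad C_{N,t}^{\mathrm{wave}}=C_2(t)\frac{\|f\|_{C^3([0,1]^3)}}{\|U_tf\|_{L^2([0,1]^3)}}\,\frac1N,$$ and $r_{N,t}^{\mathrm{wave}}=A_t^{\mathrm{wave}}+B_t^{\mathrm{wave}}+C_{N,t}^{\mathrm{wave}}$. Then $$FR(g_t)\le r_{N,t}^{\mathrm{wave}} .$$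
   Context: $\mathbb{Z}_N=\mathbb{Z}/N\mathbb{Z}$. A function that is $1$-periodic in each variable and belongs to $C^k([0,1]^d)$ means a function on $\mathbb{R}^d$ that is $1$-periodic in each variable and of class $C^k$, and $\|F\|_{C^k([0,1]^d)}=\sum_{|\alpha|\le k}\sup_{[0,1]^d}|\partial^\alpha F|$. For $f$ with Fourier series $f(x)=\sum_{k\in\mathbb{Z}^3}a_ke^{2\pi ik\cdot x}$ and $t>0$, the periodic wave snapshot is $U_tf(x)=\sum_{k\in\mathbb{Z}^3}b_k(t)e^{2\pi ik\cdot x}$, where $b_k(t)=\frac{\sin(2\pi t|k|)}{2\pi|k|}a_k$ for $k\ne0$ and $b_0(t)=t\,a_0$. (It is the time-$t$ solution of $u_{tt}=\Delta u$, $u(\cdot,0)=0$, $u_t(\cdot,0)=f$.) For $h:\mathbb{Z}_N^d\to\mathbb{C}$ the discrete Fourier transform is $\widehat h(m)=N^{-d/2}\sum_{x\in\mathbb{Z}_N^d}e^{-2\pi i x\cdot m/N}h(x)$, $m\in\mathbb{Z}_N^d$. The Fourier ratio is $FR(h)=\|\widehat h\|_1/\|\widehat h\|_2$ for $h\not\equiv 0$ and $FR(h)=0$ if $h\equiv0$, where $\|\widehat h\|_p=\left(\sum_{m}|\widehat h(m)|^p\right)^{1/p}$. The constant $C_3>0$ is a fixed absolute constant such that for every integer $N\ge2$ and every $F\in C^2([0,1]^3)$ that is $1$-periodic in each variable, $$\left|\frac1{N^3}\sum_{x\in\mathbb{Z}_N^3}|F(x/N)|^2-\int_{[0,1]^3}|F(u)|^2\,du\right|\le\frac{C_3}{N}\|F\|_{C^2([0,1]^3)}^2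 .$$ *)

theory Defs
  imports "HOL-Analysis.Analysis"
begin

definition unit_cube :: "(real ^ 'n) set" where
  "unit_cube = cbox 0 (\<chi> i. 1)"

definition periodic :: "(real ^ 'n \<Rightarrow> 'a) \<Rightarrow> bool" where
  "periodic F \<longleftrightarrow> (\<forall>x i. F (x + axis i 1) = F x)"

subsection \<open>The classes $C^k$ and their norms\<close>

definition has_partial :: "'n::finite \<Rightarrow> (real ^ 'n \<Rightarrow> 'a::real_normed_vector) \<Rightarrow> bool" where
  "has_partial i F \<longleftrightarrow> (\<forall>x. (\<lambda>s. F (x + s *\<^sub>R axis i 1)) differentiable (at 0))"

definition partial :: "'n::finite \<Rightarrow> (real ^ 'n \<Rightarrow> 'a::real_normed_vector) \<Rightarrow> real ^ 'n \<Rightarrow> 'a" where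
  "partial i F = (\<lambda>x. vector_derivative (\<lambda>s. F (x + s *\<^sub>R axis i 1)) (at 0))"

text \<open>Class $C^k$ on the whole space: all partial derivatives of order at most $k$, taken in
  any order, exist and are continuous.\<close>

fun C_class :: "nat \<Rightarrow> (real ^ 'n::finite \<Rightarrow> 'a::real_normed_vector) \<Rightarrow> bool" where
  "C_class 0 F \<longleftrightarrow> continuous_on UNIV F"
| "C_class (Suc k) F \<longleftrightarrow>
     continuous_on UNIV F \<and> (\<forall>i. has_partial i F \<and> C_class k (partial i F))"

text \<open>The derivative for the multi-index \<open>\<alpha>\<close>. The elements of the index type \<open>3\<close> are written
  \<open>1\<close>, \<open>2\<close>, \<open>3\<close> (where \<open>3 = 0\<close>).\<close>

definition multi_partial :: "(3 \<Rightarrow> nat) \<Rightarrow> (real ^ 3 \<Rightarrow> 'a::real_normed_vector) \<Rightarrow> real ^ 3 \<Rightarrow> 'a" where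
  "multi_partial \<alpha> F =
     (partial 1 ^^ \<alpha> 1) ((partial 2 ^^ \<alpha> 2) ((partial 3 ^^ \<alpha> 3) F))"

text \<open>The supremum is a real one, so this is meaningful for \<open>F\<close> of class $C^k$ only.\<close>

definition C_norm :: "nat \<Rightarrow> (real ^ 3 \<Rightarrow> 'a::real_normed_vector) \<Rightarrow> real" where
  "C_norm k F = (\<Sum>\<alpha> | (\<Sum>i\<in>UNIV. \<alpha> i) \<le> k. SUP x\<in>unit_cube. norm (multi_partial \<alpha> F x))"

definition L2_cube :: "(real ^ 'n \<Rightarrow> complex) \<Rightarrow> real" where
  "L2_cube F = sqrt (integral unit_cube (\<lambda>x. (norm (F x))\<^sup>2))"

subsection \<open>Fourier series and the periodic wave snapshot\<close>

definition real_vec :: "int ^ 'n \<Rightarrow> real ^ 'n" where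
  "real_vec k = (\<chi> i. of_int (k $ i))"

definition fourier_coeff :: "(real ^ 'n \<Rightarrow> complex) \<Rightarrow> int ^ 'n \<Rightarrow> complex" where
  "fourier_coeff f k = integral unit_cube (\<lambda>x. f x * cis (- (2 * pi * (real_vec k \<bullet> x))))"

definition wave_coeff :: "real \<Rightarrow> (real ^ 3 \<Rightarrow> real) \<Rightarrow> int ^ 3 \<Rightarrow> complex" where
  "wave_coeff t f k =
     (if k = 0 then of_real t
      else of_real (sin (2 * pi * t * norm (real_vec k)) / (2 * pi * norm (real_vec k))))
     * fourier_coeff (\<lambda>x. of_real (f x)) k"

definition wave_snapshot :: "real \<Rightarrow> (real ^ 3 \<Rightarrow> real) \<Rightarrow> real ^ 3 \<Rightarrow> complex" where
  "wave_snapshot t f x = (\<Sum>\<^sub>\<infinity>k\<in>UNIV. wave_coeff t f k * cis (2 * pi * (real_vec k \<bullet> x)))"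

subsection \<open>The discrete torus and the Fourier ratio\<close>

text \<open>Elements of $\mathbb{Z}_N^d$ are represented by integer vectors with entries in
  $\{0, \dots, N-1\}$; a function on $\mathbb{Z}_N^d$ is a function on integer vectors of which only
  the values at these representatives are used.\<close>

definition ZN :: "nat \<Rightarrow> (int ^ 'n) set" where
  "ZN N = {x. \<forall>i. x $ i \<in> {0..<int N}}"

definition discretize :: "nat \<Rightarrow> (real ^ 'n \<Rightarrow> complex) \<Rightarrow> int ^ 'n \<Rightarrow> complex" where
  "discretize N F x = F (real_vec x /\<^sub>R real N)"

definition dft :: "nat \<Rightarrow> (int ^ 'n \<Rightarrow> complex) \<Rightarrow> int ^ 'n \<Rightarrow> complex" where
  "dft N h m = of_real (real N powr (- (real CARD('n) / 2)))
     * (\<Sum>x\<in>ZN N. cis (- (2 * pi * (real_vec x \<bullet> real_vec m) / real N)) * h x)"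

definition lp_ZN :: "real \<Rightarrow> nat \<Rightarrow> (int ^ 'n \<Rightarrow> complex) \<Rightarrow> real" where
  "lp_ZN p N h = (\<Sum>m\<in>ZN N. norm (h m) powr p) powr (1 / p)"

definition fourier_ratio :: "nat \<Rightarrow> (int ^ 'n \<Rightarrow> complex) \<Rightarrow> real" where
  "fourier_ratio N h =
     (if \<forall>x\<in>ZN N. h x = 0 then 0 else lp_ZN 1 N (dft N h) / lp_ZN 2 N (dft N h))"

text \<open>The property required of the absolute constant $C_3$.\<close>

definition quadrature_constant :: "real \<Rightarrow> bool" where
  "quadrature_constant C \<longleftrightarrow> C > 0 \<and>
     (\<forall>N\<ge>2. \<forall>F :: real ^ 3 \<Rightarrow> complex. periodic F \<longrightarrow> C_class 2 F \<longrightarrow>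
        \<bar>(\<Sum>x\<in>ZN N. (norm (discretize N F x))\<^sup>2) / real N ^ 3
          - integral unit_cube (\<lambda>u. (norm (F u))\<^sup>2)\<bar>
        \<le> C / real N * (C_norm 2 F)\<^sup>2)"

end

theory Submission
  imports Defs
begin

text \<open>
  The Fourier ratio of $g_t$ is the quotient of the \<open>\<ell>\<^sup>1\<close> and \<open>\<ell>\<^sup>2\<close> norms of its discrete Fourier
  transform. Let $b_k$ be the Fourier coefficients of $U_t f$ and $a_k$ those of $f$.

  Denominator. By Plancherel it is the \<open>\<ell>\<^sup>2\<close> norm of the samples of $U_t f$. The quadrature estimate and
  the largeness of \<open>N\<close> say that the mean square of the samples is at least three quarters of
  $\|U_t f\|_2^2$, so the denominator is at least $N^{3/2}\|U_t f\|_2/2$.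

  Numerator. A sampled character is transformed into a multiple of a point mass, of \<open>\<ell>\<^sup>1\<close> norm
  $N^{3/2}$ independently of its frequency. So the numerator is at most $N^{3/2} \sum_k |b_k|$
  (\<open>sum_norm_dft_trig_series_le\<close>). Since $|b_k| \le (1+t)|a_k|/(1+|k|)$ for all \<open>k\<close>, including zero, and three
  integrations by parts give $|a_k| \le c\,\|f\|_{C^3}(1+|k|)^{-3}$, the sum is at most
  $c\,(1+t)\|f\|_{C^3}\sum_k (1+|k|)^{-4}$, a convergent series in dimension three
  (\<open>norm_wave_coeff_le_C_norm\<close>). This has the form of the term $B$; the two other terms of the bound are
  nonnegative.

  The quadrature estimate applies to functions of class $C^2$ only, and the sum defining $U_t f$ has to
  be differentiated twice term by term. This requires $\sum_k (1+|k|)^2 |b_k| < \infty$, which pointwise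
  decay of $a_k$ does not give. It follows from Bessel's inequality for the third derivatives of $f$
  and the Cauchy-Schwarz inequality, because $\sum_k (1+|k|)^{-4}$ converges
  (\<open>fourier_coeff_power_summable\<close>, \<open>C_class_trig_series\<close>).

  Both integration by parts and the orthogonality behind Bessel's inequality come from one fact: a
  partial derivative of a periodic function has integral zero over the unit cube
  (\<open>integral_partial_eq_0\<close>).
\<close>

section \<open>Characters of the torus\<close>

definition char_fun :: "int ^ 'n::finite \<Rightarrow> real ^ 'n \<Rightarrow> complex" where
  "char_fun k x = cis (2 * pi * (real_vec k \<bullet> x))"

lemma real_vec_add: "real_vec (k + l) = real_vec k + real_vec l"
  and real_vec_uminus: "real_vec (- k) = - real_vec k"
  and real_vec_zero [simp]: "real_vec 0 = 0"
  by (auto simp: real_vec_def vec_eq_iff)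

lemma norm_char_fun [simp]: "norm (char_fun k x) = 1"
  by (simp add: char_fun_def)

lemma char_fun_add: "char_fun k (x + y) = char_fun k x * char_fun k y"
  by (simp add: char_fun_def inner_add_right distrib_left cis_mult)

lemma char_fun_add_left: "char_fun (k + l) x = char_fun k x * char_fun l x"
  by (simp add: char_fun_def real_vec_add inner_add_left distrib_left cis_mult)

lemma char_fun_uminus_left: "char_fun (- k) x = cnj (char_fun k x)"
  by (simp add: char_fun_def real_vec_uminus cis_cnj)

lemma char_fun_zero [simp]: "char_fun 0 = (\<lambda>_. 1)"
  by (simp add: char_fun_def fun_eq_iff)

lemma char_fun_axis: "char_fun k (s *\<^sub>R axis i 1) = cis (2 * pi * of_int (k $ i) * s)"
  by (simp add: char_fun_def real_vec_def inner_axis mult_ac)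

lemma periodic_char_fun: "periodic (char_fun k)"
proof -
  have "char_fun k (axis i 1) = 1" for i
    using char_fun_axis[of k 1 i] by simp
  then show ?thesis
    by (simp add: periodic_def char_fun_add)
qed

lemma continuous_on_char_fun [continuous_intros]:
  "continuous_on S g \<Longrightarrow> continuous_on S (\<lambda>x. char_fun k (g x))"
  unfolding char_fun_def by (intro continuous_intros)

section \<open>Sums over boxes of integer vectors\<close>

lemma cis_sum: "cis (\<Sum>i\<in>A. f i) = (\<Prod>i\<in>A. cis (f i))"
  by (induction A rule: infinite_finite_induct) (auto simp flip: cis_mult)

text \<open>A product of one-variable sums expands into a sum over a box. It serves twice: it reduces
  orthogonality of the characters of $\mathbb{Z}_N^d$ to geometric sums, and it bounds lattice sums
  by products of convergent one-dimensional series.\<close>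

lemma sum_box_prod:
  fixes \<phi> :: "'n::finite \<Rightarrow> int \<Rightarrow> 'a::comm_semiring_1"
  assumes "finite A"
  shows "(\<Sum>k\<in>{k. \<forall>i. k $ i \<in> A}. \<Prod>i\<in>UNIV. \<phi> i (k $ i)) = (\<Prod>i\<in>UNIV. \<Sum>j\<in>A. \<phi> i j)"
proof -
  have "(\<Prod>i\<in>UNIV. \<Sum>j\<in>A. \<phi> i j) = (\<Sum>g\<in>PiE UNIV (\<lambda>_. A). \<Prod>i\<in>UNIV. \<phi> i (g i))"
    using assms by (intro prod_sum_PiE) auto
  also have "\<dots> = (\<Sum>k\<in>{k. \<forall>i. k $ i \<in> A}. \<Prod>i\<in>UNIV. \<phi> i (k $ i))"
    by (intro sum.reindex_bij_witness[where i = vec_nth and j = vec_lambda]) auto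
  finally show ?thesis by simp
qed

lemma finite_box:
  assumes "finite A"
  shows "finite {k :: 'a ^ 'n. \<forall>i. k $ i \<in> A}"
proof -
  have "{k :: 'a ^ 'n. \<forall>i. k $ i \<in> A} \<subseteq> vec_lambda ` PiE UNIV (\<lambda>_. A)"
    by (auto intro!: image_eqI[of _ vec_lambda "vec_nth _"])
  with assms show ?thesis
    by (meson finite_PiE finite finite_imageI finite_subset)
qed

lemma finite_ZN [simp]: "finite (ZN N)"
  unfolding ZN_def by (rule finite_box) simp

lemma sum_roots_of_unity:
  assumes "N > 0"
  shows "(\<Sum>j\<in>{0..<int N}. cis (2 * pi * of_int m * of_int j / N))
       = (if int N dvd m then of_nat N else 0)"
proof -
  define w where "w = cis (2 * pi * of_int m / N)"
  have w: "w ^ j = cis (2 * pi * of_int m * of_int (int j) / N)" for j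
    by (simp add: w_def Complex.DeMoivre mult_ac)
  have "(\<Sum>j\<in>{0..<int N}. cis (2 * pi * of_int m * of_int j / N)) = (\<Sum>j<N. w ^ j)"
    unfolding w by (rule sum.reindex_bij_witness[where i = int and j = nat]) auto
  moreover have "w ^ N = 1"
    unfolding w using assms by simp
  moreover have "w = 1 \<longleftrightarrow> int N dvd m"
  proof
    assume "w = 1"
    then have "cos (2 * pi * of_int m / N) = 1"
      by (simp add: w_def complex_eq_iff)
    then obtain n :: int where "2 * pi * of_int m / N = n * 2 * pi"
      by (auto simp: cos_one_2pi_int)
    then have "of_int m = (of_int (n * int N) :: real)"
      using assms by (simp add: field_simps)
    then have "m = n * int N"
      by linarith
    then show "int N dvd m" by simp
  next
    assume "int N dvd m"
    then obtain n where "m = int N * n" ..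
    then have "2 * pi * of_int m / N = 2 * pi * of_int n"
      using assms by simp
    then have "w = cis (2 * pi * of_int n)"
      by (simp only: w_def)
    then show "w = 1" by simp
  qed
  ultimately show ?thesis
    by (auto simp: sum_gp_strict)
qed

text \<open>Orthogonality of characters on $\mathbb{Z}_N^d$: the sum factors over the coordinates, and a
  coordinate factor vanishes as soon as its frequency is not a multiple of \<open>N\<close>.\<close>

lemma sum_char_ZN:
  fixes k :: "int ^ 'n"
  assumes "N > 0"
  shows "(\<Sum>x\<in>ZN N. char_fun k (real_vec x /\<^sub>R real N))
       = (if \<forall>i. int N dvd k $ i then of_nat N ^ CARD('n) else 0)"
proof -
  have "char_fun k (real_vec x /\<^sub>R real N)
      = (\<Prod>i\<in>UNIV. cis (2 * pi * of_int (k $ i) * of_int (x $ i) / N))" for x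
    unfolding cis_sum[symmetric] char_fun_def inner_vec_def sum_distrib_left
    by (intro arg_cong[where f = cis] sum.cong refl) (simp add: real_vec_def field_simps)
  then have "(\<Sum>x\<in>ZN N. char_fun k (real_vec x /\<^sub>R real N))
      = (\<Prod>i\<in>UNIV. \<Sum>j\<in>{0..<int N}. cis (2 * pi * of_int (k $ i) * of_int j / N))"
    unfolding ZN_def
    using sum_box_prod[of "{0..<int N}" "\<lambda>i j. cis (2 * pi * of_int (k $ i) * of_int j / N)"]
    by simp
  also have "\<dots> = (\<Prod>i\<in>UNIV. if int N dvd k $ i then of_nat N else 0)"
    using assms by (simp add: sum_roots_of_unity)
  also have "\<dots> = (if \<forall>i. int N dvd k $ i then of_nat N ^ CARD('n) else 0)"
    by (auto intro: prod_zero)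
  finally show ?thesis .
qed

section \<open>The discrete Fourier transform\<close>

lemma dft_char:
  fixes h :: "int ^ 'n \<Rightarrow> complex"
  shows "dft N h m = of_real (real N powr (- (real CARD('n) / 2)))
     * (\<Sum>x\<in>ZN N. cnj (char_fun m (real_vec x /\<^sub>R real N)) * h x)"
  unfolding dft_def char_fun_def cis_cnj
  by (intro arg_cong2[where f = "(*)"] sum.cong refl arg_cong[where f = cis])
     (simp add: inner_commute field_simps)

text \<open>Points and frequencies of the discrete torus are both integer vectors and enter the kernel
  symmetrically, so orthogonality can be applied to sums over frequencies as well.\<close>

lemma char_fun_symmetric:
  "char_fun m (real_vec x /\<^sub>R c) = char_fun x (real_vec m /\<^sub>R c)"
  by (simp add: char_fun_def inner_commute)

lemma ZN_eq_if_dvd: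
  assumes "x \<in> ZN N" "y \<in> ZN N" "\<forall>i. int N dvd (x - y) $ i"
  shows "x = y"
proof -
  have "x $ i = y $ i" for i
  proof -
    have "(x $ i) mod int N = (y $ i) mod int N"
      using assms(3) by (simp add: mod_eq_dvd_iff)
    with assms(1,2) show ?thesis
      by (simp add: ZN_def)
  qed
  then show ?thesis by (simp add: vec_eq_iff)
qed

text \<open>Expanding the square gives a sum over pairs \<open>x\<close>, \<open>y\<close> in which the inner sum over frequencies
  kills all pairs with \<open>x \<noteq> y\<close>; the normalisation $N^{-d/2}$ makes the transform an isometry.\<close>

lemma plancherel_ZN:
  fixes h :: "int ^ 'n \<Rightarrow> complex"
  assumes "N > 0"
  shows "(\<Sum>m\<in>ZN N. (norm (dft N h m))\<^sup>2) = (\<Sum>x\<in>ZN N. (norm (h x))\<^sup>2)"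
proof -
  define c where "c = real N powr (- (real CARD('n) / 2))"
  have c: "c * c = 1 / real N ^ CARD('n)"
    using assms by (simp add: c_def powr_minus powr_realpow field_simps flip: powr_add)
  have "complex_of_real (\<Sum>m\<in>ZN N. (norm (dft N h m))\<^sup>2)
      = (\<Sum>m\<in>ZN N. dft N h m * cnj (dft N h m))"
    unfolding of_real_sum complex_norm_square ..
  also have "\<dots> = (\<Sum>m\<in>ZN N. of_real (c * c) * (\<Sum>x\<in>ZN N. \<Sum>y\<in>ZN N. h x * cnj (h y) *
      char_fun (y - x) (real_vec m /\<^sub>R real N)))"
    unfolding dft_char c_def[symmetric] diff_conv_add_uminus char_fun_add_left char_fun_uminus_left
    by (subst (2) char_fun_symmetric)
       (simp add: sum_product char_fun_symmetric mult_ac)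
  also have "\<dots> = of_real (c * c) * (\<Sum>x\<in>ZN N. \<Sum>y\<in>ZN N. h x * cnj (h y) *
      (\<Sum>m\<in>ZN N. char_fun (y - x) (real_vec m /\<^sub>R real N)))"
    unfolding sum_distrib_left[symmetric]
    by (subst sum.swap, rule arg_cong, rule sum.cong, rule refl, subst sum.swap)
       (simp add: sum_distrib_left)
  also have "\<dots> = of_real (c * c) * (\<Sum>x\<in>ZN N. \<Sum>y\<in>ZN N.
      if x = y then h x * cnj (h y) * of_nat N ^ CARD('n) else 0)"
    using ZN_eq_if_dvd assms
    by (intro arg_cong[where f = "(*) _"] sum.cong refl) (auto simp: sum_char_ZN)
  also have "\<dots> = of_real (\<Sum>x\<in>ZN N. (norm (h x))\<^sup>2)"
    unfolding of_real_sum complex_norm_square using assms by (simp add: c sum_distrib_left)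
  finally show ?thesis
    by (simp only: of_real_eq_iff)
qed

text \<open>Sampling a character of frequency \<open>k\<close> aliases it to the residue of \<open>k\<close> modulo \<open>N\<close>, so its
  transform is concentrated at a single point, whatever \<open>k\<close> is.\<close>

lemma sum_norm_dft_char:
  fixes k :: "int ^ 'n"
  assumes "N > 0"
  shows "(\<Sum>m\<in>ZN N. norm (dft N (\<lambda>x. char_fun k (real_vec x /\<^sub>R real N)) m))
       = real N powr (real CARD('n) / 2)"
proof -
  \<comment> \<open>the only frequency in the discrete torus that \<open>k\<close> is aliased to\<close>
  define r where "r = (\<chi> i. (k $ i) mod int N)"
  have r: "r \<in> ZN N" "\<forall>i. int N dvd (k - r) $ i"
    using assms by (auto simp: r_def ZN_def minus_mod_eq_mult_div)
  have uniq: "m = r" if "m \<in> ZN N" "\<forall>i. int N dvd (k - m) $ i" for m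
  proof (rule ZN_eq_if_dvd[OF that(1) r(1)])
    have "(m - r) $ i = (k - r) $ i - (k - m) $ i" for i
      by simp
    then show "\<forall>i. int N dvd (m - r) $ i"
      using that(2) r(2) by (metis dvd_diff)
  qed
  have "dft N (\<lambda>x. char_fun k (real_vec x /\<^sub>R real N)) m
      = of_real (real N powr (- (real CARD('n) / 2)))
        * (if m = r then of_nat N ^ CARD('n) else 0)" if "m \<in> ZN N" for m
  proof -
    have "(\<Sum>x\<in>ZN N. cnj (char_fun m (real_vec x /\<^sub>R real N)) * char_fun k (real_vec x /\<^sub>R real N))
      = (\<Sum>x\<in>ZN N. char_fun (k - m) (real_vec x /\<^sub>R real N))"
      unfolding diff_conv_add_uminus char_fun_add_left char_fun_uminus_left
      by (simp add: mult.commute)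
    also have "\<dots> = (if m = r then of_nat N ^ CARD('n) else 0)"
      unfolding sum_char_ZN[OF assms] using r(2) uniq[OF that] by (intro if_cong refl) blast
    finally show ?thesis
      by (simp add: dft_char)
  qed
  then have "(\<Sum>m\<in>ZN N. norm (dft N (\<lambda>x. char_fun k (real_vec x /\<^sub>R real N)) m))
      = (\<Sum>m\<in>ZN N. if m = r then real N powr (- (real CARD('n) / 2)) * real N ^ CARD('n) else 0)"
    by (intro sum.cong refl) (simp add: norm_mult norm_power)
  also have "\<dots> = real N powr (real CARD('n) / 2)"
    using r(1) assms by (simp add: powr_realpow[symmetric] flip: powr_add)
  finally show ?thesis .
qed

lemma has_sum_finite_sum:
  fixes f :: "'a \<Rightarrow> 'b \<Rightarrow> 'c::topological_comm_monoid_add"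
  assumes "\<And>m. m \<in> M \<Longrightarrow> (f m has_sum s m) A"
  shows "((\<lambda>k. \<Sum>m\<in>M. f m k) has_sum (\<Sum>m\<in>M. s m)) A"
  using assms by (induction M rule: infinite_finite_induct) (auto intro: has_sum_add)

lemma summable_on_finite_sum:
  fixes f :: "'a \<Rightarrow> 'b \<Rightarrow> 'c::topological_comm_monoid_add"
  assumes "\<And>m. m \<in> M \<Longrightarrow> f m summable_on A"
  shows "(\<lambda>k. \<Sum>m\<in>M. f m k) summable_on A"
  using assms by (induction M rule: infinite_finite_induct) (auto intro: summable_on_add)

text \<open>The \<open>\<ell>\<^sup>1\<close> norm of the transform is a seminorm that takes the same value on all sampled
  characters, so on a series it is at most that value times the \<open>\<ell>\<^sup>1\<close> norm of the coefficients.
  The interchange of the two sums is harmless because the one over the discrete torus is finite.\<close>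

lemma sum_norm_dft_trig_series_le:
  fixes c :: "int ^ 'n \<Rightarrow> complex"
  assumes "N > 0" and c: "(\<lambda>k. norm (c k)) summable_on UNIV"
  shows "(\<Sum>m\<in>ZN N. norm (dft N (discretize N (\<lambda>x. \<Sum>\<^sub>\<infinity>k\<in>UNIV. c k * char_fun k x)) m))
       \<le> real N powr (real CARD('n) / 2) * (\<Sum>\<^sub>\<infinity>k\<in>UNIV. norm (c k))"
proof -
  define D where "D m k = dft N (\<lambda>x. char_fun k (real_vec x /\<^sub>R real N)) m" for m k :: "int ^ 'n"
  have sum_D: "(\<Sum>m\<in>ZN N. norm (D m k)) = real N powr (real CARD('n) / 2)" for k :: "int ^ 'n"
    using sum_norm_dft_char[OF assms(1)] by (simp add: D_def)
  have norm_cD: "(\<lambda>k. norm (c k) * norm (D m k)) summable_on UNIV" if "m \<in> ZN N" for m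
  proof (rule summable_on_comparison_test)
    show "(\<lambda>k. norm (c k) * real N powr (real CARD('n) / 2)) summable_on UNIV"
      by (rule summable_on_cmult_left[OF c])
    show "norm (c k) * norm (D m k) \<le> norm (c k) * real N powr (real CARD('n) / 2)" for k
      unfolding sum_D[of k, symmetric]
      by (intro mult_left_mono member_le_sum) (use that in auto)
  qed auto
  have abs: "(\<lambda>k. norm (c k * char_fun k x)) summable_on UNIV" for x
    using c by (simp add: norm_mult)
  have "dft N (discretize N (\<lambda>x. \<Sum>\<^sub>\<infinity>k\<in>UNIV. c k * char_fun k x)) m = (\<Sum>\<^sub>\<infinity>k\<in>UNIV. c k * D m k)" for m
  proof -
    have "((\<lambda>k. c k * char_fun k x) has_sum (\<Sum>\<^sub>\<infinity>k\<in>UNIV. c k * char_fun k x)) UNIV" for x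
      using abs_summable_summable[OF abs] by simp
    then have "((\<lambda>k. of_real (real N powr (- (real CARD('n) / 2))) * (\<Sum>x\<in>ZN N. cnj (char_fun m (real_vec x /\<^sub>R real N)) *
       (c k * char_fun k (real_vec x /\<^sub>R real N)))) has_sum
       of_real (real N powr (- (real CARD('n) / 2))) * (\<Sum>x\<in>ZN N. cnj (char_fun m (real_vec x /\<^sub>R real N)) *
        (\<Sum>\<^sub>\<infinity>k\<in>UNIV. c k * char_fun k (real_vec x /\<^sub>R real N)))) UNIV"
      by (intro has_sum_cmult_right has_sum_finite_sum) auto
    then have "((\<lambda>k. c k * D m k) has_sum
        dft N (discretize N (\<lambda>x. \<Sum>\<^sub>\<infinity>k\<in>UNIV. c k * char_fun k x)) m) UNIV"
      by (simp add: D_def dft_char discretize_def sum_distrib_left mult_ac)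
    then show ?thesis
      by (simp add: infsumI)
  qed
  then have "(\<Sum>m\<in>ZN N. norm (dft N (discretize N (\<lambda>x. \<Sum>\<^sub>\<infinity>k\<in>UNIV. c k * char_fun k x)) m))
      \<le> (\<Sum>m\<in>ZN N. \<Sum>\<^sub>\<infinity>k\<in>UNIV. norm (c k) * norm (D m k))"
    using norm_cD by (auto intro!: sum_mono norm_infsum_bound[THEN order_trans] simp: norm_mult)
  also have "((\<lambda>k. \<Sum>m\<in>ZN N. norm (c k) * norm (D m k)) has_sum
      (\<Sum>m\<in>ZN N. \<Sum>\<^sub>\<infinity>k\<in>UNIV. norm (c k) * norm (D m k))) UNIV"
    using norm_cD by (intro has_sum_finite_sum) auto
  then have "(\<Sum>m\<in>ZN N. \<Sum>\<^sub>\<infinity>k\<in>UNIV. norm (c k) * norm (D m k))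
      = (\<Sum>\<^sub>\<infinity>k\<in>UNIV. norm (c k) * real N powr (real CARD('n) / 2))"
    by (simp add: infsumI sum_D flip: sum_distrib_left)
  also have "\<dots> = real N powr (real CARD('n) / 2) * (\<Sum>\<^sub>\<infinity>k\<in>UNIV. norm (c k))"
    using c by (subst infsum_cmult_left) auto
  finally show ?thesis .
qed

section \<open>Calculus on the torus\<close>

lemma has_partial_imp_has_vector_derivative:
  assumes "has_partial i F"
  shows "((\<lambda>s. F (x + s *\<^sub>R axis i 1)) has_vector_derivative partial i F (x + s *\<^sub>R axis i 1))
    (at s within S)"
proof -
  have "((\<lambda>r. F ((x + s *\<^sub>R axis i 1) + r *\<^sub>R axis i 1)) has_vector_derivative
      partial i F (x + s *\<^sub>R axis i 1)) (at 0)"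
    using assms by (simp add: has_partial_def partial_def vector_derivative_works[symmetric])
  then have "(((\<lambda>r. F (x + s *\<^sub>R axis i 1 + r *\<^sub>R axis i 1)) \<circ> (\<lambda>u. u - s)) has_vector_derivative
      1 *\<^sub>R partial i F (x + s *\<^sub>R axis i 1)) (at s)"
    by (intro vector_diff_chain_at) (auto intro!: derivative_eq_intros)
  then have "((\<lambda>s. F (x + s *\<^sub>R axis i 1)) has_vector_derivative
      partial i F (x + s *\<^sub>R axis i 1)) (at s)"
    by (simp add: o_def algebra_simps)
  then show ?thesis
    by (rule has_vector_derivative_at_within)
qed

lemma partial_eqI:
  assumes "\<And>x. ((\<lambda>s. F (x + s *\<^sub>R axis i 1)) has_vector_derivative G x) (at 0)"
  shows "has_partial i F" "partial i F = G"
  using assms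
  by (auto simp: has_partial_def partial_def fun_eq_iff
      intro: differentiableI_vector vector_derivative_at)

lemma periodic_partial:
  assumes "periodic F"
  shows "periodic (partial i F)"
proof -
  have "F (x + axis j 1 + s *\<^sub>R axis i 1) = F (x + s *\<^sub>R axis i 1)" for x j s
  proof -
    have "F ((x + s *\<^sub>R axis i 1) + axis j 1) = F (x + s *\<^sub>R axis i 1)"
      using assms unfolding periodic_def by blast
    then show ?thesis by (simp add: algebra_simps)
  qed
  then show ?thesis
    by (simp add: periodic_def partial_def)
qed

text \<open>The boxes \<open>unit_cube\<close> and \<open>unit_cube + s e\<close> both arise from the
  longer box \<open>[0, 1 + s e]\<close> by removing a slab of thickness \<open>s\<close>, at the right or at the left end, and
  these two slabs differ by the period \<open>e\<close>.\<close>

lemma integral_shift_periodic: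
  fixes G :: "real ^ 'n::finite \<Rightarrow> 'a::banach"
  assumes per: "periodic G" and cont: "continuous_on UNIV G" and s: "0 \<le> s" "s \<le> 1"
  shows "integral unit_cube (\<lambda>x. G (x + s *\<^sub>R axis i 1)) = integral unit_cube G"
proof -
  define e :: "real ^ 'n" where "e = axis i 1"
  define u :: "real ^ 'n" where "u = (\<chi> i. 1)"
  have int: "G integrable_on cbox a b" for a b
    using cont by (intro integrable_continuous) (rule continuous_on_subset, auto)
  have e: "e \<in> Basis" by (simp add: e_def)
  have e_nth: "e $ j = (if j = i then 1 else 0)" for j
    by (simp add: e_def axis_def)
  have inner_e: "x \<bullet> e = x $ i" for x
    by (simp add: e_def inner_axis)
  note box = mem_box_cart set_eq_iff e_nth u_def inner_e
  have 1: "cbox 0 (u + s *\<^sub>R e) \<inter> {x. x \<bullet> e \<le> 1} = cbox 0 u"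
  proof -
    have "x \<in> cbox 0 (u + s *\<^sub>R e) \<inter> {x. x \<bullet> e \<le> 1} \<longleftrightarrow> x \<in> cbox 0 u" for x
      using s by (simp add: box) (smt (verit, best))
    then show ?thesis by blast
  qed
  have 2: "cbox 0 (u + s *\<^sub>R e) \<inter> {x. x \<bullet> e \<ge> 1} = cbox e (u + s *\<^sub>R e)"
  proof -
    have "x \<in> cbox 0 (u + s *\<^sub>R e) \<inter> {x. x \<bullet> e \<ge> 1} \<longleftrightarrow> x \<in> cbox e (u + s *\<^sub>R e)" for x
      using s by (simp add: box) (smt (verit, best))
    then show ?thesis by blast
  qed
  have 3: "cbox 0 (u + s *\<^sub>R e) \<inter> {x. x \<bullet> e \<ge> s} = cbox (s *\<^sub>R e) (u + s *\<^sub>R e)"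
  proof -
    have "x \<in> cbox 0 (u + s *\<^sub>R e) \<inter> {x. x \<bullet> e \<ge> s} \<longleftrightarrow> x \<in> cbox (s *\<^sub>R e) (u + s *\<^sub>R e)" for x
      using s by (simp add: box) (smt (verit, best))
    then show ?thesis by blast
  qed
  have 4: "cbox 0 (u + s *\<^sub>R e) \<inter> {x. x \<bullet> e \<le> s} = cbox 0 (u - e + s *\<^sub>R e)"
  proof -
    have "x \<in> cbox 0 (u + s *\<^sub>R e) \<inter> {x. x \<bullet> e \<le> s} \<longleftrightarrow> x \<in> cbox 0 (u - e + s *\<^sub>R e)" for x
      using s by (simp add: box) (smt (verit, best))
    then show ?thesis by blast
  qed
  have "integral (cbox 0 u) G + integral (cbox e (u + s *\<^sub>R e)) G
      = integral (cbox 0 (u - e + s *\<^sub>R e)) G + integral (cbox (s *\<^sub>R e) (u + s *\<^sub>R e)) G"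
    using integral_split[OF int e, of 0 "u + s *\<^sub>R e" 1] integral_split[OF int e, of 0 "u + s *\<^sub>R e" s]
    unfolding 1 2 3 4 by simp
  moreover have "integral (cbox e (u + s *\<^sub>R e)) G = integral (cbox 0 (u - e + s *\<^sub>R e)) G"
  proof -
    have "G (x + e) = G x" for x
      using per by (simp add: periodic_def e_def)
    then show ?thesis
      using integral_shift_cbox[of e e "u + s *\<^sub>R e" G] by (simp add: algebra_simps)
  qed
  ultimately have "integral (cbox (s *\<^sub>R e) (u + s *\<^sub>R e)) G = integral (cbox 0 u) G"
    by simp
  then show ?thesis
    using integral_shift_cbox[of "s *\<^sub>R e" "s *\<^sub>R e" "u + s *\<^sub>R e" G]
    by (simp add: unit_cube_def e_def u_def)
qed

text \<open>By translation invariance the integral of \<open>G (x + s e)\<close> over the cube is constant in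
  \<open>s\<close>; differentiating under the integral sign at \<open>s = 0\<close> gives the integral of the partial
  derivative. This replaces Fubini and the fundamental theorem of calculus in one coordinate, and is
  the source both of orthogonality and of integration by parts.\<close>

lemma integral_partial_eq_0:
  fixes G :: "real ^ 'n::finite \<Rightarrow> 'a::banach"
  assumes per: "periodic G" and C1: "C_class 1 G"
  shows "integral unit_cube (partial i G) = 0"
proof -
  have cont: "continuous_on S G" and cont': "continuous_on S (partial i G)"
    and hp: "has_partial i G" for S
    using C1 continuous_on_subset[of UNIV G S] continuous_on_subset[of UNIV "partial i G" S]
    by auto
  let ?h = "\<lambda>s. integral unit_cube (\<lambda>x. G (x + s *\<^sub>R axis i 1))"
  have "(?h has_vector_derivative integral unit_cube (\<lambda>x. partial i G (x + 0 *\<^sub>R axis i 1)))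
      (at 0 within {0..1})"
    unfolding unit_cube_def
    by (rule leibniz_rule_vector_derivative)
       (auto intro!: has_partial_imp_has_vector_derivative hp integrable_continuous continuous_intros
          continuous_on_compose2[OF cont] continuous_on_compose2[OF cont'] simp: split_def)
  then have "((\<lambda>_. integral unit_cube G) has_vector_derivative integral unit_cube (partial i G))
      (at 0 within {0..1})"
    using integral_shift_periodic[OF per cont]
    by (auto intro: has_vector_derivative_transform[where f = ?h])
  then show ?thesis
    using vector_derivative_unique_within_closed_interval[of 0 1 0 "\<lambda>_. integral unit_cube G"]
    by simp
qed

lemma partial_mult:
  fixes F G :: "real ^ 'n::finite \<Rightarrow> 'a::real_normed_algebra"
  assumes "has_partial i F" "has_partial i G"
  shows "has_partial i (\<lambda>x. F x * G x)"
    and "partial i (\<lambda>x. F x * G x) = (\<lambda>x. F x * partial i G x + partial i F x * G x)"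
proof -
  have "((\<lambda>s. F (x + s *\<^sub>R axis i 1) * G (x + s *\<^sub>R axis i 1)) has_vector_derivative
      F x * partial i G x + partial i F x * G x) (at 0)" for x
    using has_vector_derivative_mult[OF
        has_partial_imp_has_vector_derivative[OF assms(1), of x 0 UNIV]
        has_partial_imp_has_vector_derivative[OF assms(2), of x 0 UNIV]] by simp
  note * = partial_eqI[OF this]
  show "has_partial i (\<lambda>x. F x * G x)"
    and "partial i (\<lambda>x. F x * G x) = (\<lambda>x. F x * partial i G x + partial i F x * G x)"
    using * by auto
qed

lemma char_fun_has_vector_derivative:
  "((\<lambda>s. char_fun k (x + s *\<^sub>R axis i 1)) has_vector_derivative
     2 * pi * \<i> * of_int (k $ i) * char_fun k x) (at 0)"
proof -
  have "((\<lambda>s. cis (2 * pi * of_int (k $ i) * s)) has_vector_derivative 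
     2 * pi * \<i> * of_int (k $ i)) (at 0)"
    unfolding cis_conv_exp
    by (auto intro!: derivative_eq_intros has_vector_derivative_real_field simp: field_simps)
  then show ?thesis
    unfolding char_fun_add char_fun_axis
    by (auto dest: has_vector_derivative_mult_right[of _ _ _ "char_fun k x"] simp: mult_ac)
qed

lemmas has_partial_char_fun = partial_eqI(1)[OF char_fun_has_vector_derivative]
  and partial_char_fun = partial_eqI(2)[OF char_fun_has_vector_derivative]

lemma C_class_1_char_fun: "C_class 1 (char_fun k)"
  by (simp add: has_partial_char_fun partial_char_fun continuous_intros)

lemma measure_unit_cube: "measure lborel (unit_cube :: (real ^ 'n::finite) set) = 1"
proof -
  have "(0 :: real ^ 'n) \<in> unit_cube"
    by (simp add: unit_cube_def mem_box_cart)
  then show ?thesis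
    unfolding unit_cube_def by (subst content_cbox_cart) auto
qed

lemma integral_char_fun:
  fixes k :: "int ^ 'n::finite"
  shows "integral unit_cube (char_fun k) = (if k = 0 then 1 else 0)"
proof (cases "k = 0")
  case True
  then show ?thesis
    using measure_unit_cube[where 'n = 'n]
    by (simp add: unit_cube_def)
next
  case False
  then obtain i where i: "k $ i \<noteq> 0"
    by (auto simp: vec_eq_iff)
  have "0 = integral unit_cube (\<lambda>x. 2 * pi * \<i> * of_int (k $ i) * char_fun k x)"
    using integral_partial_eq_0[OF periodic_char_fun[of k] C_class_1_char_fun, of i]
    by (simp add: partial_char_fun)
  also have "\<dots> = 2 * pi * \<i> * of_int (k $ i) * integral unit_cube (char_fun k)"
    by (rule integral_mult_right)
  finally show ?thesis
    using False i by simp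
qed

lemma fourier_coeff_char: "fourier_coeff F k = integral unit_cube (\<lambda>x. F x * char_fun (- k) x)"
  by (simp add: fourier_coeff_def char_fun_def real_vec_uminus)

text \<open>Integration by parts: the partial derivative of \<open>F\<close> times a character integrates to zero.\<close>

lemma fourier_coeff_partial:
  assumes per: "periodic F" and C1: "C_class 1 F"
  shows "fourier_coeff (partial i F) k = 2 * pi * \<i> * of_int (k $ i) * fourier_coeff F k"
proof -
  have cont: "continuous_on S F" and cont': "continuous_on S (partial i F)"
    and hp: "has_partial i F" for S i
    using C1 continuous_on_subset[of UNIV F S] continuous_on_subset[of UNIV "partial i F" S]
    by auto
  let ?G = "\<lambda>x. F x * char_fun (- k) x"
  have partial_G: "partial i ?G = (\<lambda>x. F x * (2 * pi * \<i> * of_int (- k $ i) * char_fun (- k) x)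
      + partial i F x * char_fun (- k) x)" for i
    by (simp add: partial_mult hp has_partial_char_fun partial_char_fun)
  have "C_class 1 ?G"
    by (auto simp: partial_G hp has_partial_char_fun partial_mult
        intro!: continuous_intros cont cont')
  moreover have "periodic ?G"
    using per periodic_char_fun[of "- k"] by (simp add: periodic_def)
  ultimately have "0 = integral unit_cube (partial i ?G)"
    using integral_partial_eq_0 by metis
  also have "\<dots> = integral unit_cube (\<lambda>x. F x * (2 * pi * \<i> * of_int (- k $ i) * char_fun (- k) x))
      + integral unit_cube (\<lambda>x. partial i F x * char_fun (- k) x)"
    unfolding partial_G unit_cube_def
    by (intro integral_add integrable_continuous continuous_intros cont cont')
  also have "(\<lambda>x. F x * (2 * pi * \<i> * of_int (- k $ i) * char_fun (- k) x))
      = (\<lambda>x. 2 * pi * \<i> * of_int (- k $ i) * ?G x)"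
    by (simp add: mult_ac)
  also have "integral unit_cube \<dots> = 2 * pi * \<i> * of_int (- k $ i) * integral unit_cube ?G"
    by (rule integral_mult_right)
  finally show ?thesis
    by (simp add: fourier_coeff_char)
qed

text \<open>Expand the integral of $|F - P|^2 \ge 0$, where \<open>P\<close> is the partial Fourier sum over \<open>K\<close>: both
  mixed terms and the square of \<open>P\<close> equal the sum of the squared coefficients.\<close>

lemma bessel_inequality:
  fixes F :: "real ^ 'n::finite \<Rightarrow> complex"
  assumes cont: "continuous_on UNIV F" and "finite K"
  shows "(\<Sum>k\<in>K. (norm (fourier_coeff F k))\<^sup>2) \<le> integral unit_cube (\<lambda>x. (norm (F x))\<^sup>2)"
proof -
  note cont' = continuous_on_subset[OF cont]
  let ?a = "fourier_coeff F"
  define P where "P x = (\<Sum>k\<in>K. ?a k * char_fun k x)" for x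
  have intble: "f integrable_on unit_cube" if "continuous_on UNIV f" for f :: "real ^ 'n \<Rightarrow> complex"
    using that unfolding unit_cube_def by (intro integrable_continuous) (rule continuous_on_subset, auto)
  have cont_P: "continuous_on S P" for S
    unfolding P_def by (intro continuous_intros)
  have FP: "integral unit_cube (\<lambda>x. F x * cnj (P x)) = (\<Sum>k\<in>K. ?a k * cnj (?a k))"
  proof -
    have "integral unit_cube (\<lambda>x. F x * cnj (P x))
        = integral unit_cube (\<lambda>x. \<Sum>k\<in>K. cnj (?a k) * (F x * char_fun (- k) x))"
      by (simp add: P_def sum_distrib_left mult_ac char_fun_uminus_left)
    also have "\<dots> = (\<Sum>k\<in>K. integral unit_cube (\<lambda>x. cnj (?a k) * (F x * char_fun (- k) x)))"
      by (intro integral_sum intble continuous_intros assms) 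
    also have "\<dots> = (\<Sum>k\<in>K. ?a k * cnj (?a k))"
      by (simp add: fourier_coeff_char mult.commute)
    finally show ?thesis .
  qed
  have PP: "integral unit_cube (\<lambda>x. P x * cnj (P x)) = (\<Sum>k\<in>K. ?a k * cnj (?a k))"
  proof -
    have "integral unit_cube (\<lambda>x. P x * cnj (P x))
        = integral unit_cube (\<lambda>x. \<Sum>k\<in>K. \<Sum>l\<in>K. ?a k * cnj (?a l) * char_fun (k + - l) x)"
      unfolding char_fun_add_left char_fun_uminus_left
      by (simp add: P_def sum_product mult_ac)
    also have "\<dots> = (\<Sum>k\<in>K. integral unit_cube (\<lambda>x. \<Sum>l\<in>K. ?a k * cnj (?a l) * char_fun (k + - l) x))"
      by (intro integral_sum intble continuous_intros assms)
    also have "\<dots> = (\<Sum>k\<in>K. \<Sum>l\<in>K. integral unit_cube (\<lambda>x. ?a k * cnj (?a l) * char_fun (k + - l) x))"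
      by (intro sum.cong refl integral_sum intble continuous_intros assms)
    also have "\<dots> = (\<Sum>k\<in>K. \<Sum>l\<in>K. if l = k then ?a k * cnj (?a l) else 0)"
      by (intro sum.cong refl) (simp add: integral_char_fun)
    also have "\<dots> = (\<Sum>k\<in>K. ?a k * cnj (?a k))"
      using assms by simp
    finally show ?thesis .
  qed
  have "integral unit_cube (\<lambda>x. cnj (F x * cnj (P x))) = cnj (\<Sum>k\<in>K. ?a k * cnj (?a k))"
    using FP integral_cnj by metis
  then have PF: "integral unit_cube (\<lambda>x. P x * cnj (F x)) = (\<Sum>k\<in>K. ?a k * cnj (?a k))"
    by (simp add: mult_ac)
  have eq: "complex_of_real ((norm (F x - P x))\<^sup>2)
      = F x * cnj (F x) - F x * cnj (P x) - P x * cnj (F x) + P x * cnj (P x)" for x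
    unfolding complex_norm_square by (simp add: algebra_simps)
  have re: "integral unit_cube (\<lambda>x. complex_of_real ((norm (g x))\<^sup>2))
      = of_real (integral unit_cube (\<lambda>x. (norm (g x))\<^sup>2))"
    if "continuous_on UNIV g" for g :: "real ^ 'n \<Rightarrow> complex"
    unfolding unit_cube_def using continuous_on_subset[OF that]
    by (intro integral_unique has_integral_of_real integrable_integral integrable_continuous
        continuous_intros) auto
  have "of_real (integral unit_cube (\<lambda>x. (norm (F x - P x))\<^sup>2))
      = integral unit_cube (\<lambda>x. F x * cnj (F x)) - integral unit_cube (\<lambda>x. F x * cnj (P x))
        - integral unit_cube (\<lambda>x. P x * cnj (F x)) + integral unit_cube (\<lambda>x. P x * cnj (P x))"
    unfolding re[OF continuous_on_diff[OF cont cont_P], symmetric] eq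
    by (simp add: integral_add integral_diff integrable_diff intble continuous_intros cont cont_P)
  also have "\<dots> = integral unit_cube (\<lambda>x. of_real ((norm (F x))\<^sup>2)) - (\<Sum>k\<in>K. ?a k * cnj (?a k))"
    by (simp add: FP PF PP complex_norm_square del: of_real_power)
  also have "\<dots> = of_real (integral unit_cube (\<lambda>x. (norm (F x))\<^sup>2) - (\<Sum>k\<in>K. (norm (?a k))\<^sup>2))"
    unfolding of_real_diff re[OF cont, symmetric] of_real_sum complex_norm_square ..
  finally have "integral unit_cube (\<lambda>x. (norm (F x - P x))\<^sup>2)
      = integral unit_cube (\<lambda>x. (norm (F x))\<^sup>2) - (\<Sum>k\<in>K. (norm (?a k))\<^sup>2)"
    by (simp only: of_real_eq_iff)
  moreover have "integral unit_cube (\<lambda>x. (norm (F x - P x))\<^sup>2) \<ge> 0"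
    unfolding unit_cube_def
    by (intro Henstock_Kurzweil_Integration.integral_nonneg integrable_continuous continuous_intros cont' cont_P) auto
  ultimately show ?thesis by simp
qed

section \<open>Trigonometric series\<close>

text \<open>Difference quotients turn termwise differentiation of a series into the interchange of a limit
  with an infinite sum.\<close>

lemma has_vector_derivative_at_0_iff:
  "(g has_vector_derivative D) (at 0) \<longleftrightarrow> ((\<lambda>s. (g s - g 0) /\<^sub>R s) \<longlongrightarrow> D) (at 0)"
proof -
  have "(g has_vector_derivative D) (at 0)
      \<longleftrightarrow> ((\<lambda>s. norm (g s - g 0 - s *\<^sub>R D) / norm s) \<longlongrightarrow> 0) (at 0)"
    by (simp add: has_vector_derivative_def has_derivative_at bounded_linear_scaleR_left)
  also have "\<dots> \<longleftrightarrow> ((\<lambda>s. norm ((g s - g 0) /\<^sub>R s - D)) \<longlongrightarrow> 0) (at 0)"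
  proof (rule tendsto_cong)
    have "norm (g s - g 0 - s *\<^sub>R D) / norm s = norm ((g s - g 0) /\<^sub>R s - D)" if "s \<noteq> 0" for s
    proof -
      have "(g s - g 0) /\<^sub>R s - D = (g s - g 0 - s *\<^sub>R D) /\<^sub>R s"
        using that by (simp add: scaleR_diff_right)
      then show ?thesis
        by (simp add: divide_inverse mult.commute)
    qed
    then show "\<forall>\<^sub>F s in at 0. norm (g s - g 0 - s *\<^sub>R D) / norm s = norm ((g s - g 0) /\<^sub>R s - D)"
      by (auto simp: eventually_at_filter)
  qed
  also have "\<dots> \<longleftrightarrow> ((\<lambda>s. (g s - g 0) /\<^sub>R s) \<longlongrightarrow> D) (at 0)"
    by (simp add: tendsto_norm_zero_iff LIM_zero_iff)
  finally show ?thesis .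
qed

lemma norm_cis_diff_1_le: "norm (cis s - 1) \<le> \<bar>s\<bar>"
proof -
  have "norm (cis s - 1) = 2 * \<bar>sin (s / 2)\<bar>"
    using dist_exp_i_1[of s] by (simp add: cis_conv_exp)
  also have "\<dots> \<le> 2 * \<bar>s / 2\<bar>"
    by (intro mult_left_mono abs_sin_x_le_abs_x) auto
  finally show ?thesis by simp
qed

definition trig_series :: "(int ^ 'n::finite \<Rightarrow> complex) \<Rightarrow> real ^ 'n \<Rightarrow> complex" where
  "trig_series c x = (\<Sum>\<^sub>\<infinity>k\<in>UNIV. c k * char_fun k x)"

lemma periodic_trig_series: "periodic (trig_series c)"
  by (simp add: periodic_def trig_series_def periodic_char_fun[unfolded periodic_def, rule_format])

lemma trig_series_shift: "trig_series c (x + real_vec l) = trig_series c x"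
proof -
  have "char_fun k (real_vec l) = cis (2 * pi * of_int (\<Sum>i\<in>UNIV. k $ i * l $ i))" for k
    by (simp add: char_fun_def real_vec_def inner_vec_def)
  then have "char_fun k (real_vec l) = 1" for k
    by (simp del: of_int_sum)
  then show ?thesis
    by (simp add: trig_series_def char_fun_add)
qed

lemma continuous_on_trig_series:
  assumes "(\<lambda>k. norm (c k)) summable_on UNIV"
  shows "continuous_on UNIV (trig_series c)"
proof (rule uniform_limit_theorem)
  show "uniform_limit UNIV (\<lambda>K x. \<Sum>k\<in>K. c k * char_fun k x) (trig_series c)
      (finite_subsets_at_top UNIV)"
    unfolding trig_series_def
    by (rule Weierstrass_m_test_general[OF _ assms]) (simp add: norm_mult)
  show "\<forall>\<^sub>F K in finite_subsets_at_top UNIV. continuous_on UNIV (\<lambda>x. \<Sum>k\<in>K. c k * char_fun k x)"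
    by (intro always_eventually allI continuous_intros)
qed (simp add: finite_subsets_at_top_neq_bot)

text \<open>The difference quotients of the terms are bounded uniformly in the increment by summable
  numbers, since a character is Lipschitz along the axis with constant $2\pi|k_i|$. Hence their sum
  converges uniformly in the increment, and the limit may be taken term by term.\<close>

lemma trig_series_has_vector_derivative:
  fixes c :: "int ^ 'n::finite \<Rightarrow> complex"
  assumes summable: "(\<lambda>k. norm (c k) * (1 + norm (real_vec k))) summable_on UNIV"
  shows "((\<lambda>s. trig_series c (x + s *\<^sub>R axis i 1)) has_vector_derivative
     trig_series (\<lambda>k. 2 * pi * \<i> * of_int (k $ i) * c k) x) (at 0)"
proof -
  let ?e = "axis i 1 :: real ^ 'n"
  let ?c' = "\<lambda>k. 2 * pi * \<i> * of_int (k $ i) * c k"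
  \<comment> \<open>at \<open>s = 0\<close> the quotient is zero by the convention for inverses, so the bound below
      holds for all \<open>s\<close>\<close>
  define q where "q k s = c k * ((char_fun k (x + s *\<^sub>R ?e) - char_fun k x) /\<^sub>R s)" for k s
  have abs_k: "\<bar>real_of_int (k $ i)\<bar> \<le> norm (real_vec k)" for k :: "int ^ 'n"
    using component_le_norm_cart[of "real_vec k" i] by (simp add: real_vec_def)
  have "norm (c k) \<le> norm (c k) * (1 + norm (real_vec k))" for k
    by (simp add: mult_le_cancel_left1 algebra_simps)
  then have abs_c: "(\<lambda>k. norm (c k)) summable_on UNIV"
    by (intro summable_on_comparison_test[OF summable]) auto
  have series: "((\<lambda>k. c k * char_fun k y) has_sum trig_series c y) UNIV" for y
    using abs_summable_summable[of "\<lambda>k. c k * char_fun k y" UNIV] abs_c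
    by (simp add: trig_series_def norm_mult)
  have summable': "(\<lambda>k. 2 * pi * (norm (c k) * (1 + norm (real_vec k)))) summable_on UNIV"
    by (rule summable_on_cmult_right[OF summable])
  have "norm (?c' k) \<le> 2 * pi * (norm (c k) * (1 + norm (real_vec k)))" for k
  proof -
    have "norm (?c' k) = 2 * pi * (norm (c k) * \<bar>real_of_int (k $ i)\<bar>)"
      by (simp add: norm_mult)
    then show ?thesis
      using abs_k[of k] by (simp add: mult_left_mono)
  qed
  then have "(\<lambda>k. norm (?c' k)) summable_on UNIV"
    by (intro summable_on_comparison_test[OF summable']) auto
  then have series': "((\<lambda>k. ?c' k * char_fun k x) has_sum trig_series ?c' x) UNIV"
    using abs_summable_summable[of "\<lambda>k. ?c' k * char_fun k x" UNIV]
    by (simp add: trig_series_def norm_mult)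
  have bound: "norm (q k s) \<le> 2 * pi * (norm (c k) * (1 + norm (real_vec k)))" for k s
  proof (cases "s = 0")
    case False
    have "norm (char_fun k (x + s *\<^sub>R ?e) - char_fun k x) = norm (cis (2 * pi * of_int (k $ i) * s) - 1)"
      using norm_mult[of "char_fun k x" "cis (2 * pi * of_int (k $ i) * s) - 1"]
      by (simp add: char_fun_add char_fun_axis algebra_simps)
    also have "\<dots> \<le> \<bar>2 * pi * of_int (k $ i) * s\<bar>"
      by (rule norm_cis_diff_1_le)
    also have "\<dots> = 2 * pi * \<bar>real_of_int (k $ i)\<bar> * \<bar>s\<bar>"
      by (simp add: abs_mult)
    also have "\<dots> \<le> 2 * pi * (1 + norm (real_vec k)) * \<bar>s\<bar>"
      using abs_k[of k] by (intro mult_right_mono mult_left_mono) auto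
    finally have "norm ((char_fun k (x + s *\<^sub>R ?e) - char_fun k x) /\<^sub>R s)
        \<le> 2 * pi * (1 + norm (real_vec k))"
      using False by (simp add: divide_inverse[symmetric] pos_divide_le_eq mult.commute[of "inverse _"])
    then have "norm (q k s) \<le> norm (c k) * (2 * pi * (1 + norm (real_vec k)))"
      unfolding q_def norm_mult by (intro mult_left_mono) auto
    then show ?thesis
      by (simp add: mult_ac)
  qed (simp add: q_def)
  have q_lim: "(q k \<longlongrightarrow> ?c' k * char_fun k x) (at 0)" for k
    using tendsto_mult_left[OF char_fun_has_vector_derivative[of k x i, unfolded has_vector_derivative_at_0_iff], of "c k"]
    by (simp add: q_def[abs_def] mult_ac)
  have "((\<lambda>s. \<Sum>\<^sub>\<infinity>k\<in>UNIV. q k s) \<longlongrightarrow> trig_series ?c' x) (at 0 within UNIV)"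
  proof (rule swap_uniform_limit)
    show "\<forall>\<^sub>F K in finite_subsets_at_top UNIV.
        ((\<lambda>s. \<Sum>k\<in>K. q k s) \<longlongrightarrow> (\<Sum>k\<in>K. ?c' k * char_fun k x)) (at 0 within UNIV)"
      by (intro always_eventually allI tendsto_sum q_lim)
    show "((\<lambda>K. \<Sum>k\<in>K. ?c' k * char_fun k x) \<longlongrightarrow> trig_series ?c' x) (finite_subsets_at_top UNIV)"
      using series' by (simp add: has_sum_def)
    show "uniform_limit UNIV (\<lambda>K s. \<Sum>k\<in>K. q k s) (\<lambda>s. \<Sum>\<^sub>\<infinity>k\<in>UNIV. q k s) (finite_subsets_at_top UNIV)"
      by (rule Weierstrass_m_test_general[OF bound summable'])
  qed (simp add: finite_subsets_at_top_neq_bot)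
  moreover have "(\<Sum>\<^sub>\<infinity>k\<in>UNIV. q k s) = (trig_series c (x + s *\<^sub>R ?e) - trig_series c (x + 0 *\<^sub>R ?e)) /\<^sub>R s" for s
  proof (rule infsumI)
    have "((\<lambda>k. c k * char_fun k (x + s *\<^sub>R ?e) + - (c k * char_fun k x)) has_sum
        trig_series c (x + s *\<^sub>R ?e) + - trig_series c x) UNIV"
      by (intro has_sum_add series) (simp add: has_sum_uminus series)
    from has_sum_scaleR[OF this, of "inverse s"]
    show "((\<lambda>k. q k s) has_sum (trig_series c (x + s *\<^sub>R ?e) - trig_series c (x + 0 *\<^sub>R ?e)) /\<^sub>R s) UNIV"
      by (simp add: q_def algebra_simps)
  qed
  ultimately show ?thesis
    unfolding has_vector_derivative_at_0_iff by simp
qed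

text \<open>Each differentiation multiplies the \<open>k\<close>-th coefficient by at most a constant times the weight
  \<open>1 + norm (real_vec k)\<close>, and so uses up one power of it.\<close>

lemma C_class_trig_series:
  assumes "(\<lambda>k. norm (c k) * (1 + norm (real_vec k)) ^ m) summable_on UNIV"
  shows "C_class m (trig_series c)"
  using assms
proof (induction m arbitrary: c)
  case 0
  then show ?case by (simp add: continuous_on_trig_series)
next
  case (Suc m)
  let ?w = "\<lambda>k. 1 + norm (real_vec k)"
  have "norm (c k) * ?w k \<le> norm (c k) * ?w k ^ Suc m" for k
    using power_increasing[of 1 "Suc m" "?w k"] by (intro mult_left_mono) auto
  then have 1: "(\<lambda>k. norm (c k) * ?w k) summable_on UNIV"
    by (intro summable_on_comparison_test[OF Suc.prems]) auto
  have "norm (c k) \<le> norm (c k) * ?w k" for k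
    by (simp add: mult_le_cancel_left1 algebra_simps)
  then have 0: "(\<lambda>k. norm (c k)) summable_on UNIV"
    by (intro summable_on_comparison_test[OF 1]) auto
  note partial = partial_eqI[OF trig_series_has_vector_derivative[OF 1]]
  have "C_class m (trig_series (\<lambda>k. 2 * pi * \<i> * of_int (k $ i) * c k))" for i
  proof (rule Suc.IH)
    have "norm (2 * pi * \<i> * of_int (k $ i) * c k) * ?w k ^ m
        \<le> 2 * pi * (norm (c k) * ?w k ^ Suc m)" for k
    proof -
      have "\<bar>real_of_int (k $ i)\<bar> \<le> ?w k"
        using component_le_norm_cart[of "real_vec k" i] by (simp add: real_vec_def)
      then have "2 * pi * (norm (c k) * ?w k ^ m) * \<bar>real_of_int (k $ i)\<bar>
          \<le> 2 * pi * (norm (c k) * ?w k ^ m) * ?w k"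
        by (intro mult_left_mono) auto
      then show ?thesis
        by (simp add: norm_mult mult_ac)
    qed
    then show "(\<lambda>k. norm (2 * pi * \<i> * of_int (k $ i) * c k) * ?w k ^ m) summable_on UNIV"
      by (intro summable_on_comparison_test[OF summable_on_cmult_right[OF Suc.prems, of "2 * pi"]]) auto
  qed
  with 0 show ?case
    by (simp add: partial continuous_on_trig_series)
qed

section \<open>Lattice sums\<close>

lemma summable_on_int_powr:
  assumes "s > 1"
  shows "(\<lambda>j::int. (1 + \<bar>real_of_int j\<bar>) powr - s) summable_on UNIV"
proof -
  let ?f = "\<lambda>j::int. (1 + \<bar>real_of_int j\<bar>) powr - s"
  have "summable (\<lambda>n. real (Suc n) powr - s)"
    using assms by (subst summable_Suc_iff) (simp add: summable_real_powr_iff)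
  then have *: "(\<lambda>n. (1 + real n) powr - s) summable_on UNIV"
    by (intro summable_nonneg_imp_summable_on) auto
  have "?f summable_on range int"
    using * by (subst summable_on_reindex) (auto simp: o_def)
  moreover have "?f summable_on range (\<lambda>n. - int n)"
    using * by (subst summable_on_reindex) (auto simp: o_def inj_on_def)
  moreover have "range int \<union> range (\<lambda>n. - int n) = UNIV"
  proof -
    have "j \<in> range int \<union> range (\<lambda>n. - int n)" for j
      by (cases j rule: int_cases2) auto
    then show ?thesis by blast
  qed
  ultimately show ?thesis
    by (metis summable_on_union)
qed

text \<open>With \<open>s = p / CARD('n) > 1\<close> the weight is bounded by a product of one-variable weights with exponent
  \<open>- s\<close>, because the norm dominates every coordinate.\<close>

lemma summable_on_lattice_powr:
  assumes "p > real CARD('n)"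
  shows "(\<lambda>k :: int ^ 'n::finite. (1 + norm (real_vec k)) powr - p) summable_on UNIV"
proof (rule nonneg_bdd_above_summable_on)
  define s where "s = p / CARD('n)"
  have s: "s > 1" and p: "p = real CARD('n) * s"
    using assms by (auto simp: s_def field_simps)
  let ?f = "\<lambda>j::int. (1 + \<bar>real_of_int j\<bar>) powr - s"
  have "sum (\<lambda>k. (1 + norm (real_vec k)) powr - p) K \<le> (\<Sum>\<^sub>\<infinity>j\<in>UNIV. ?f j) ^ CARD('n)"
    if K: "finite K" for K :: "(int ^ 'n) set"
  proof -
    \<comment> \<open>\<open>K\<close> is contained in a box with side \<open>A\<close>\<close>
    define A where "A = (\<Union>k\<in>K. range (vec_nth k))"
    have A: "finite A" "K \<subseteq> {k. \<forall>i. k $ i \<in> A}"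
      using K by (auto simp: A_def)
    have "(1 + norm (real_vec k)) powr - p \<le> (\<Prod>i\<in>UNIV. ?f (k $ i))" for k :: "int ^ 'n"
    proof -
      have "1 + norm (real_vec k) \<noteq> 0"
        using norm_ge_zero[of "real_vec k"] by linarith
      then have "(1 + norm (real_vec k)) powr - p = (\<Prod>i\<in>(UNIV :: 'n set). (1 + norm (real_vec k)) powr - s)"
        by (simp add: p powr_power mult.commute)
      also have "\<dots> \<le> (\<Prod>i\<in>UNIV. ?f (k $ i))"
        using s component_le_norm_cart[of "real_vec k"]
        by (intro prod_mono conjI powr_mono2') (auto simp: real_vec_def)
      finally show ?thesis .
    qed
    then have "sum (\<lambda>k. (1 + norm (real_vec k)) powr - p) K \<le> (\<Sum>k\<in>K. \<Prod>i\<in>UNIV. ?f (k $ i))"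
      by (intro sum_mono) auto
    also have "\<dots> \<le> (\<Sum>k\<in>{k :: int ^ 'n. \<forall>i. k $ i \<in> A}. \<Prod>i\<in>UNIV. ?f (k $ i))"
      using A by (intro sum_mono2 finite_box prod_nonneg) auto
    also have "\<dots> = (\<Prod>i\<in>(UNIV :: 'n set). \<Sum>j\<in>A. ?f j)"
      using A(1) by (rule sum_box_prod)
    also have "\<dots> \<le> (\<Prod>i\<in>(UNIV :: 'n set). \<Sum>\<^sub>\<infinity>j\<in>UNIV. ?f j)"
      using summable_on_int_powr[OF s] A(1)
      by (intro prod_mono conjI sum_nonneg finite_sum_le_infsum) auto
    finally show ?thesis by simp
  qed
  then show "bdd_above (sum (\<lambda>k :: int ^ 'n. (1 + norm (real_vec k)) powr - p) ` {K. K \<subseteq> UNIV \<and> finite K})"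
    by (auto intro!: bdd_aboveI2)
qed simp

section \<open>Fourier coefficients of smooth functions\<close>

lemma C_class_imp_continuous: "C_class m F \<Longrightarrow> continuous_on UNIV F"
  by (cases m) auto

lemma C_class_antimono: "C_class m F \<Longrightarrow> n \<le> m \<Longrightarrow> C_class n F"
proof (induction n arbitrary: m F)
  case 0
  then show ?case by (simp add: C_class_imp_continuous)
next
  case (Suc n)
  then obtain m' where "m = Suc m'"
    by (cases m) auto
  with Suc show ?case by auto
qed

lemma C_class_funpow_partial: "C_class (m + n) F \<Longrightarrow> C_class n ((partial i ^^ m) F)"
  by (induction m arbitrary: F) (auto simp: funpow_Suc_right simp del: funpow.simps)

lemma fourier_coeff_funpow_partial:
  assumes "periodic F" "C_class m F"
  shows "fourier_coeff ((partial i ^^ m) F) k = (2 * pi * \<i> * of_int (k $ i)) ^ m * fourier_coeff F k"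
  using assms
proof (induction m arbitrary: F)
  case (Suc m)
  have "C_class 1 F"
    using Suc.prems(2) by (rule C_class_antimono) simp
  moreover have "C_class m (partial i F)"
    using Suc.prems(2) by simp
  ultimately show ?case
    using Suc.prems(1)
    by (simp add: funpow_Suc_right Suc.IH periodic_partial fourier_coeff_partial mult_ac
        del: funpow.simps)
qed simp

lemma norm_fourier_coeff_le:
  fixes G :: "real ^ 'n::finite \<Rightarrow> complex"
  assumes "continuous_on UNIV G" and M: "\<And>x. x \<in> unit_cube \<Longrightarrow> norm (G x) \<le> M"
  shows "norm (fourier_coeff G k) \<le> M"
proof -
  have "(0 :: real ^ 'n) \<in> unit_cube"
    by (simp add: unit_cube_def mem_box_cart)
  then have "M \<ge> 0"
    using M norm_ge_zero order_trans by blast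
  moreover have "((\<lambda>x. G x * char_fun (- k) x) has_integral fourier_coeff G k) (cbox 0 (\<chi> i. 1))"
    unfolding fourier_coeff_char unit_cube_def
    by (intro integrable_integral integrable_continuous continuous_intros
        continuous_on_subset[OF assms(1)]) auto
  ultimately show ?thesis
    using has_integral_bound[of M "\<lambda>x. G x * char_fun (- k) x" "fourier_coeff G k" 0 "\<chi> i. 1"] M
    by (simp add: norm_mult unit_cube_def[symmetric] measure_unit_cube)
qed

text \<open>Bessel bounds all finite partial sums by the same integral.\<close>

lemma fourier_coeff_square_summable:
  fixes G :: "real ^ 'n::finite \<Rightarrow> complex"
  assumes "continuous_on UNIV G"
  shows "(\<lambda>k. (norm (fourier_coeff G k))\<^sup>2) summable_on UNIV"
  using bessel_inequality[OF assms]
  by (intro nonneg_bdd_above_summable_on) (auto intro!: bdd_aboveI2)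

lemma norm_real_vec_power_le:
  fixes k :: "int ^ 'n::finite"
  shows "norm (real_vec k) ^ m \<le> real CARD('n) ^ m * (\<Sum>i\<in>UNIV. \<bar>real_of_int (k $ i)\<bar> ^ m)"
proof -
  define M where "M = Max (range (\<lambda>i. \<bar>real_of_int (k $ i)\<bar>))"
  have "M \<in> range (\<lambda>i. \<bar>real_of_int (k $ i)\<bar>)"
    unfolding M_def by (intro Max_in) auto
  then obtain j where j: "M = \<bar>real_of_int (k $ j)\<bar>" by blast
  have "norm (real_vec k) \<le> (\<Sum>i\<in>UNIV. \<bar>real_of_int (k $ i)\<bar>)"
    using norm_le_l1_cart[of "real_vec k"] by (simp add: real_vec_def)
  also have "\<dots> \<le> (\<Sum>i\<in>(UNIV :: 'n set). M)"
    unfolding M_def by (intro sum_mono Max_ge) auto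
  finally have "norm (real_vec k) ^ m \<le> (real CARD('n) * M) ^ m"
    by (intro power_mono) auto
  also have "\<dots> \<le> real CARD('n) ^ m * (\<Sum>i\<in>UNIV. \<bar>real_of_int (k $ i)\<bar> ^ m)"
    unfolding power_mult_distrib j
    by (intro mult_left_mono member_le_sum) auto
  finally show ?thesis .
qed

text \<open>The pure derivatives of order \<open>m\<close> suffice: the norm of \<open>k\<close> is at most \<open>CARD('n)\<close> times the largest
  coordinate, in whose direction \<open>m\<close> integrations by parts gain the factor $(2\pi|k_i|)^m$. The
  coefficient itself on the right accounts for the summand \<open>1\<close> of the weight.\<close>

lemma fourier_coeff_decay:
  fixes F :: "real ^ 'n::finite \<Rightarrow> complex"
  assumes "periodic F" "C_class m F"
  shows "norm (fourier_coeff F k) * (1 + norm (real_vec k)) ^ m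
    \<le> (2 * real CARD('n)) ^ m * (norm (fourier_coeff F k)
        + (\<Sum>i\<in>UNIV. norm (fourier_coeff ((partial i ^^ m) F) k)))"
proof -
  let ?a = "norm (fourier_coeff F k)" and ?n = "real CARD('n)" and ?r = "norm (real_vec k)"
  have n: "?n ^ m \<ge> 1"
    by (intro one_le_power) (simp add: Suc_leI)
  have partial: "\<bar>real_of_int (k $ i)\<bar> ^ m * ?a \<le> norm (fourier_coeff ((partial i ^^ m) F) k)" for i
  proof -
    have "1 * \<bar>real_of_int (k $ i)\<bar> \<le> 2 * pi * \<bar>real_of_int (k $ i)\<bar>"
      using pi_gt3 by (intro mult_right_mono) auto
    then have "\<bar>real_of_int (k $ i)\<bar> ^ m \<le> (2 * pi * \<bar>real_of_int (k $ i)\<bar>) ^ m"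
      by (intro power_mono) auto
    then show ?thesis
      by (simp add: fourier_coeff_funpow_partial[OF assms] norm_mult norm_power mult_right_mono)
  qed
  have "1 + ?r \<le> 2 * max 1 ?r"
    by auto
  then have "(1 + ?r) ^ m \<le> (2 * max 1 ?r) ^ m"
    by (intro power_mono) auto
  also have "\<dots> \<le> 2 ^ m * (1 + ?r ^ m)"
    unfolding power_mult_distrib by (intro mult_left_mono) (auto simp: max_def)
  also have "\<dots> \<le> 2 ^ m * (?n ^ m * 1 + ?n ^ m * (\<Sum>i\<in>UNIV. \<bar>real_of_int (k $ i)\<bar> ^ m))"
    using n norm_real_vec_power_le[of k m] by (intro mult_left_mono add_mono) auto
  also have "\<dots> = (2 * ?n) ^ m * (1 + (\<Sum>i\<in>UNIV. \<bar>real_of_int (k $ i)\<bar> ^ m))"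
    by (simp add: power_mult_distrib algebra_simps)
  finally have "?a * (1 + ?r) ^ m \<le> ?a * ((2 * ?n) ^ m * (1 + (\<Sum>i\<in>UNIV. \<bar>real_of_int (k $ i)\<bar> ^ m)))"
    by (intro mult_left_mono) auto
  also have "\<dots> = (2 * ?n) ^ m * (?a + (\<Sum>i\<in>UNIV. \<bar>real_of_int (k $ i)\<bar> ^ m * ?a))"
    by (simp add: sum_distrib_left algebra_simps)
  also have "\<dots> \<le> (2 * ?n) ^ m * (?a + (\<Sum>i\<in>UNIV. norm (fourier_coeff ((partial i ^^ m) F) k)))"
    by (intro mult_left_mono add_left_mono sum_mono partial) auto
  finally show ?thesis .
qed

lemma fourier_coeff_decay_sup:
  fixes F :: "real ^ 'n::finite \<Rightarrow> complex"
  assumes F: "periodic F" "C_class m F"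
    and M: "\<And>x. x \<in> unit_cube \<Longrightarrow> norm (F x) \<le> M"
      "\<And>i x. x \<in> unit_cube \<Longrightarrow> norm ((partial i ^^ m) F x) \<le> M"
  shows "norm (fourier_coeff F k) * (1 + norm (real_vec k)) ^ m
    \<le> (2 * real CARD('n)) ^ m * (1 + real CARD('n)) * M"
proof -
  have "continuous_on UNIV ((partial i ^^ m) F)" for i
    using C_class_funpow_partial[of m 0 F i] F by simp
  then have "norm (fourier_coeff ((partial i ^^ m) F) k) \<le> M" for i
    using M(2) by (intro norm_fourier_coeff_le) auto
  then have "(\<Sum>i\<in>UNIV. norm (fourier_coeff ((partial i ^^ m) F) k)) \<le> (\<Sum>i\<in>(UNIV :: 'n set). M)"
    by (intro sum_mono)
  moreover have "norm (fourier_coeff F k) \<le> M"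
    using F M(1) by (intro norm_fourier_coeff_le C_class_imp_continuous) auto
  ultimately have "norm (fourier_coeff F k) + (\<Sum>i\<in>UNIV. norm (fourier_coeff ((partial i ^^ m) F) k))
      \<le> (1 + real CARD('n)) * M"
    by (simp add: algebra_simps)
  then have "(2 * real CARD('n)) ^ m * (norm (fourier_coeff F k)
        + (\<Sum>i\<in>UNIV. norm (fourier_coeff ((partial i ^^ m) F) k)))
      \<le> (2 * real CARD('n)) ^ m * ((1 + real CARD('n)) * M)"
    by (intro mult_left_mono) auto
  from order_trans[OF fourier_coeff_decay[OF F] this] show ?thesis
    by (simp only: mult.assoc)
qed

text \<open>The Cauchy-Schwarz inequality for Bessel and a convergent lattice sum, in the form
  \<open>x * y \<le> x\<^sup>2 + y\<^sup>2\<close>.\<close>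

lemma fourier_coeff_weighted_summable:
  fixes G :: "real ^ 'n::finite \<Rightarrow> complex"
  assumes "continuous_on UNIV G" "2 * s > real CARD('n)"
  shows "(\<lambda>k. norm (fourier_coeff G k) * (1 + norm (real_vec k)) powr - s) summable_on UNIV"
proof (rule summable_on_comparison_test)
  show "(\<lambda>k. (norm (fourier_coeff G k))\<^sup>2 + (1 + norm (real_vec k)) powr - (2 * s)) summable_on UNIV"
    by (intro summable_on_add fourier_coeff_square_summable summable_on_lattice_powr assms)
  show "norm (fourier_coeff G k) * (1 + norm (real_vec k)) powr - s
      \<le> (norm (fourier_coeff G k))\<^sup>2 + (1 + norm (real_vec k)) powr - (2 * s)" for k
  proof -
    have "(1 + norm (real_vec k)) powr - (2 * s) = ((1 + norm (real_vec k)) powr - s)\<^sup>2"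
      by (simp add: power2_eq_square flip: powr_add)
    moreover have "x * y \<le> x\<^sup>2 + y\<^sup>2" if "x \<ge> 0" "y \<ge> 0" for x y :: real
      using sum_squares_bound[of x y] mult_nonneg_nonneg[OF that] by linarith
    ultimately show ?thesis by simp
  qed
qed auto

text \<open>Square summability of the coefficients of the derivatives costs only half of the dimension,
  where pointwise decay costs all of it. For \<open>m = 3\<close>, \<open>j = 1\<close> in dimension three, the case behind
  twice differentiable wave snapshots, pointwise decay would leave the divergent sum of $|k|^{-2}$.\<close>

lemma fourier_coeff_power_summable:
  fixes F :: "real ^ 'n::finite \<Rightarrow> complex"
  assumes F: "periodic F" "C_class m F" and j: "j \<le> m" "CARD('n) < 2 * (m - j)"
  shows "(\<lambda>k. norm (fourier_coeff F k) * (1 + norm (real_vec k)) ^ j) summable_on UNIV"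
proof (rule summable_on_comparison_test)
  let ?w = "\<lambda>k. 1 + norm (real_vec k)" and ?C = "(2 * real CARD('n)) ^ m"
  let ?E = "\<lambda>k. norm (fourier_coeff F k) + (\<Sum>i\<in>UNIV. norm (fourier_coeff ((partial i ^^ m) F) k))"
  have "continuous_on UNIV ((partial i ^^ m) F)" for i
    using C_class_funpow_partial[of m 0 F i] F by simp
  moreover have "2 * real (m - j) > real CARD('n)"
    using j by linarith
  ultimately have "(\<lambda>k. norm (fourier_coeff F k) * ?w k powr - real (m - j)
      + (\<Sum>i\<in>UNIV. norm (fourier_coeff ((partial i ^^ m) F) k) * ?w k powr - real (m - j))) summable_on UNIV"
    using F by (intro summable_on_add summable_on_finite_sum fourier_coeff_weighted_summable
        C_class_imp_continuous[of m F]) auto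
  then show "(\<lambda>k. ?C * (?E k * ?w k powr - real (m - j))) summable_on UNIV"
    by (intro summable_on_cmult_right) (simp add: distrib_right sum_distrib_right)
  show "norm (fourier_coeff F k) * ?w k ^ j \<le> ?C * (?E k * ?w k powr - real (m - j))" for k
  proof -
    have w: "?w k > 0"
      by (simp add: add_pos_nonneg)
    then have "?w k ^ j = ?w k ^ m * ?w k powr - real (m - j)"
      using j by (simp add: of_nat_diff flip: powr_realpow powr_add)
    then have "norm (fourier_coeff F k) * ?w k ^ j
        = norm (fourier_coeff F k) * ?w k ^ m * ?w k powr - real (m - j)"
      by simp
    also have "\<dots> \<le> ?C * ?E k * ?w k powr - real (m - j)"
      by (intro mult_right_mono fourier_coeff_decay F) auto
    finally show ?thesis by (simp add: mult.assoc)
  qed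
qed auto

lemma partial_of_real:
  assumes "has_partial i f"
  shows "has_partial i (\<lambda>x. complex_of_real (f x))"
    and "partial i (\<lambda>x. complex_of_real (f x)) = (\<lambda>x. complex_of_real (partial i f x))"
proof -
  have "((\<lambda>s. complex_of_real (f (x + s *\<^sub>R axis i 1))) has_vector_derivative
      complex_of_real (partial i f x)) (at 0)" for x
    using bounded_linear.has_vector_derivative[OF bounded_linear_of_real
        has_partial_imp_has_vector_derivative[OF assms, of x 0 UNIV]]
    by simp
  note * = partial_eqI[OF this]
  show "has_partial i (\<lambda>x. complex_of_real (f x))"
    and "partial i (\<lambda>x. complex_of_real (f x)) = (\<lambda>x. complex_of_real (partial i f x))"
    using * by auto
qed

lemma C_class_of_real: "C_class m f \<Longrightarrow> C_class m (\<lambda>x. complex_of_real (f x))"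
  by (induction m arbitrary: f) (auto simp: partial_of_real intro!: continuous_intros)

lemma funpow_partial_of_real:
  "C_class m f \<Longrightarrow>
    (partial i ^^ m) (\<lambda>x. complex_of_real (f x)) = (\<lambda>x. complex_of_real ((partial i ^^ m) f x))"
  by (induction m arbitrary: f)
     (auto simp: partial_of_real funpow_Suc_right simp del: funpow.simps(2))

text \<open>Every summand of the norm is a supremum of a continuous function over a compact set, hence
  bounded and nonnegative, and there are only finitely many multi-indices.\<close>

lemma norm_multi_partial_le_C_norm:
  assumes f: "C_class m f" and \<alpha>: "(\<Sum>i\<in>UNIV. \<alpha> i) \<le> m" and x: "x \<in> unit_cube"
  shows "norm (multi_partial \<alpha> f x) \<le> C_norm m f"
proof -
  let ?A = "{\<alpha> :: 3 \<Rightarrow> nat. (\<Sum>i\<in>UNIV. \<alpha> i) \<le> m}"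
  have sup: "norm (multi_partial \<beta> f y) \<le> (SUP x\<in>unit_cube. norm (multi_partial \<beta> f x))"
    if "\<beta> \<in> ?A" "y \<in> unit_cube" for \<beta> y
  proof -
    have "m = \<beta> 3 + (\<beta> 2 + (\<beta> 1 + (m - (\<beta> 1 + \<beta> 2 + \<beta> 3))))"
      using that(1) by (simp add: sum_3)
    then have "C_class (m - (\<beta> 1 + \<beta> 2 + \<beta> 3)) (multi_partial \<beta> f)"
      unfolding multi_partial_def using f by (intro C_class_funpow_partial) metis
    then have "continuous_on unit_cube (multi_partial \<beta> f)"
      using C_class_imp_continuous continuous_on_subset by blast
    then have "compact ((\<lambda>x. norm (multi_partial \<beta> f x)) ` unit_cube)"
      unfolding unit_cube_def by (intro compact_continuous_image continuous_intros) auto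
    then have "bdd_above ((\<lambda>x. norm (multi_partial \<beta> f x)) ` unit_cube)"
      by (intro bounded_imp_bdd_above compact_imp_bounded)
    with that(2) show ?thesis
      by (rule cSUP_upper)
  qed
  have "?A \<subseteq> PiE UNIV (\<lambda>_. {..m})"
  proof
    fix \<beta> assume "\<beta> \<in> ?A"
    moreover have "\<beta> i \<le> (\<Sum>i\<in>UNIV. \<beta> i)" for i
      by (rule member_le_sum) auto
    ultimately show "\<beta> \<in> PiE UNIV (\<lambda>_. {..m})"
      by (auto intro: order_trans)
  qed
  then have "finite ?A"
    by (rule finite_subset) (intro finite_PiE, auto)
  have "norm (multi_partial \<alpha> f x) \<le> (SUP x\<in>unit_cube. norm (multi_partial \<alpha> f x))"
    using \<alpha> x by (intro sup) auto
  also have "\<dots> \<le> C_norm m f"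
    unfolding C_norm_def using \<alpha> \<open>finite ?A\<close> sup[OF _ x]
    by (intro member_le_sum) (auto intro: order_trans[OF norm_ge_zero])
  finally show ?thesis .
qed

lemma funpow_partial_eq_multi_partial:
  fixes i :: 3
  shows "(partial i ^^ m) f = multi_partial (\<lambda>j. if j = i then m else 0) f"
  using exhaust_3[of i] by (auto simp: multi_partial_def)

section \<open>The Fourier ratio of the wave snapshot\<close>

text \<open>Plancherel turns the denominator of the ratio into the discrete \<open>\<ell>\<^sup>2\<close> norm of the samples,
  which is assumed to be at least half of its expected size; the numerator is controlled by the
  coefficients. The powers of \<open>N\<close> cancel.\<close>

lemma fourier_ratio_trig_series_le:
  fixes c :: "int ^ 'n::finite \<Rightarrow> complex"
  assumes N: "N > 0" and c: "(\<lambda>k. norm (c k)) summable_on UNIV"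
    and L: "L > 0"
    and lower: "real N ^ CARD('n) * (L / 2)\<^sup>2
      \<le> (\<Sum>x\<in>ZN N. (norm (discretize N (trig_series c) x))\<^sup>2)"
  shows "fourier_ratio N (discretize N (trig_series c)) \<le> 2 * (\<Sum>\<^sub>\<infinity>k\<in>UNIV. norm (c k)) / L"
proof -
  let ?h = "discretize N (trig_series c)" and ?S = "\<Sum>\<^sub>\<infinity>k\<in>UNIV. norm (c k)"
  define R where "R = real N powr (real CARD('n) / 2)"
  have R: "R > 0" "R\<^sup>2 = real N ^ CARD('n)"
    using N by (auto simp: R_def powr_realpow power2_eq_square simp flip: powr_add)
  have S: "?S \<ge> 0"
    by (rule infsum_nonneg) simp
  have "lp_ZN 1 N (dft N ?h) = (\<Sum>m\<in>ZN N. norm (dft N ?h m))"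
    by (simp add: lp_ZN_def sum_nonneg)
  also have "\<dots> \<le> R * ?S"
    using sum_norm_dft_trig_series_le[OF N c] by (simp add: R_def trig_series_def[abs_def])
  finally have l1: "lp_ZN 1 N (dft N ?h) \<le> R * ?S" .
  have "R * (L / 2) = sqrt (real N ^ CARD('n) * (L / 2)\<^sup>2)"
    using R L by (simp add: R(2)[symmetric] real_sqrt_mult)
  also have "\<dots> \<le> sqrt (\<Sum>m\<in>ZN N. (norm (dft N ?h m))\<^sup>2)"
    using lower by (simp add: plancherel_ZN[OF N])
  also have "\<dots> = lp_ZN 2 N (dft N ?h)"
    by (simp add: lp_ZN_def powr_half_sqrt sum_nonneg)
  finally have l2: "R * (L / 2) \<le> lp_ZN 2 N (dft N ?h)" .
  have "lp_ZN 1 N (dft N ?h) / lp_ZN 2 N (dft N ?h) \<le> (R * ?S) / (R * (L / 2))"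
    using l1 l2 R L S by (intro frac_le) auto
  also have "\<dots> = 2 * ?S / L"
    using R by simp
  finally show ?thesis
    using S L by (simp add: fourier_ratio_def)
qed

text \<open>The wave multiplier gains one power of the frequency. At \<open>k = 0\<close> it is \<open>t\<close>, elsewhere at most
  $1/(2\pi|k|) \le 1/(1+|k|)$, since nonzero lattice vectors have norm at least one.\<close>

lemma norm_wave_coeff_le:
  assumes "t > 0"
  shows "norm (wave_coeff t f k) * (1 + norm (real_vec k))
    \<le> (1 + t) * norm (fourier_coeff (\<lambda>x. complex_of_real (f x)) k)"
proof (cases "k = 0")
  case True
  then show ?thesis
    using assms by (simp add: wave_coeff_def norm_mult mult_right_mono)
next
  case False
  let ?r = "norm (real_vec k)" and ?a = "norm (fourier_coeff (\<lambda>x. complex_of_real (f x)) k)"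
  obtain i where "k $ i \<noteq> 0"
    using False by (auto simp: vec_eq_iff)
  then have "1 \<le> \<bar>real_of_int (k $ i)\<bar>"
    by linarith
  also have "\<dots> \<le> ?r"
    using component_le_norm_cart[of "real_vec k" i] by (simp add: real_vec_def)
  finally have r: "1 \<le> ?r" .
  have "6 * ?r \<le> 2 * pi * ?r"
    using pi_gt3 r by (intro mult_right_mono) auto
  with r have r': "1 + ?r \<le> 2 * pi * ?r"
    by linarith
  have "norm (wave_coeff t f k) * (1 + ?r) = \<bar>sin (2 * pi * t * ?r)\<bar> * ((1 + ?r) / (2 * pi * ?r)) * ?a"
    using False by (simp add: wave_coeff_def norm_mult norm_divide del: of_real_divide of_real_mult)
  also have "\<dots> \<le> 1 * 1 * ?a"
    using r r' by (intro mult_right_mono mult_mono) (auto simp: divide_le_eq_1)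
  also have "\<dots> \<le> (1 + t) * ?a"
    using assms by (intro mult_right_mono) auto
  finally show ?thesis .
qed

lemma wave_snapshot_eq_trig_series: "wave_snapshot t f = trig_series (wave_coeff t f)"
  by (simp add: fun_eq_iff wave_snapshot_def trig_series_def char_fun_def)

text \<open>This is the hypothesis of termwise differentiation to order two: one of the two powers of the
  weight is paid for by the wave multiplier, the other one by the smoothness of \<open>f\<close>.\<close>

lemma wave_coeff_summable_square:
  assumes "t > 0" and f: "periodic f" "C_class 3 f"
  shows "(\<lambda>k. norm (wave_coeff t f k) * (1 + norm (real_vec k)) ^ 2) summable_on UNIV"
proof (rule summable_on_comparison_test)
  let ?F = "\<lambda>x. complex_of_real (f x)"
  have "periodic ?F" "C_class 3 ?F"
    using f by (auto simp: periodic_def intro: C_class_of_real)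
  then have "(\<lambda>k. norm (fourier_coeff ?F k) * (1 + norm (real_vec k)) ^ 1) summable_on UNIV"
    by (rule fourier_coeff_power_summable) simp_all
  then show "(\<lambda>k. (1 + t) * (norm (fourier_coeff ?F k) * (1 + norm (real_vec k)))) summable_on UNIV"
    by (intro summable_on_cmult_right) simp
  show "norm (wave_coeff t f k) * (1 + norm (real_vec k)) ^ 2
      \<le> (1 + t) * (norm (fourier_coeff ?F k) * (1 + norm (real_vec k)))" for k
    using mult_right_mono[OF norm_wave_coeff_le[OF \<open>t > 0\<close>, of f k], of "1 + norm (real_vec k)"]
    by (simp add: power2_eq_square mult.assoc)
qed auto

text \<open>Three powers of decay come from the derivatives of \<open>f\<close> and one from the wave multiplier; four
  exceeds the dimension, so the bound is summable. The constant is $864 = (2 \cdot 3)^3 (1 + 3)$.\<close>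

lemma norm_wave_coeff_le_C_norm:
  assumes "t > 0" and f: "periodic f" "C_class 3 f"
  shows "norm (wave_coeff t f k) \<le> 864 * (1 + t) * C_norm 3 f * (1 + norm (real_vec k)) powr - 4"
proof -
  let ?F = "\<lambda>x. complex_of_real (f x)" and ?w = "1 + norm (real_vec k)"
  have F: "periodic ?F" "C_class 3 ?F"
    using f by (auto simp: periodic_def intro: C_class_of_real)
  have "norm (?F x) \<le> C_norm 3 f" if "x \<in> unit_cube" for x
    using norm_multi_partial_le_C_norm[OF f(2), of "\<lambda>_. 0" x] that
    by (simp add: multi_partial_def)
  moreover have "norm ((partial i ^^ 3) ?F x) \<le> C_norm 3 f" if "x \<in> unit_cube" for i x
  proof -
    have "norm ((partial i ^^ 3) ?F x) = norm ((partial i ^^ 3) f x)"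
      by (simp only: funpow_partial_of_real[OF f(2)] norm_of_real real_norm_def)
    also have "\<dots> \<le> C_norm 3 f"
      unfolding funpow_partial_eq_multi_partial
      using that by (intro norm_multi_partial_le_C_norm f) simp_all
    finally show ?thesis .
  qed
  ultimately have a: "norm (fourier_coeff ?F k) * ?w ^ 3 \<le> 864 * C_norm 3 f"
    using fourier_coeff_decay_sup[OF F, of "C_norm 3 f" k] by simp
  have w: "?w > 0"
    by (simp add: add_pos_nonneg)
  have "norm (wave_coeff t f k) * ?w ^ 4 = norm (wave_coeff t f k) * ?w * ?w ^ 3"
    by (simp add: power4_eq_xxxx power3_eq_cube)
  also have "\<dots> \<le> (1 + t) * norm (fourier_coeff ?F k) * ?w ^ 3"
    by (intro mult_right_mono norm_wave_coeff_le assms) auto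
  also have "\<dots> \<le> (1 + t) * (864 * C_norm 3 f)"
    using a \<open>t > 0\<close> by (simp add: mult.assoc)
  finally have "norm (wave_coeff t f k) \<le> (1 + t) * (864 * C_norm 3 f) / ?w ^ 4"
    using w by (simp add: pos_le_divide_eq)
  also have "\<dots> = 864 * (1 + t) * C_norm 3 f * ?w powr - 4"
    using w by (simp add: powr_minus divide_inverse)
  finally show ?thesis .
qed

text \<open>Translating by the integer parts brings a point where the series does not vanish into the unit
  cube, and a nonnegative continuous function with integral zero vanishes there.\<close>

lemma L2_cube_trig_series_pos:
  assumes c: "(\<lambda>k. norm (c k)) summable_on UNIV" and nz: "trig_series c x \<noteq> 0"
  shows "L2_cube (trig_series c) > 0"
proof -
  let ?U = "trig_series c"
  have cont: "continuous_on (cbox 0 (\<chi> i. 1)) (\<lambda>y. (norm (?U y))\<^sup>2)"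
    by (intro continuous_intros continuous_on_subset[OF continuous_on_trig_series[OF c]]) auto
  define l where "l = (\<chi> i. \<lfloor>x $ i\<rfloor>)"
  have "?U (x - real_vec l) \<noteq> 0"
    using nz trig_series_shift[of c "x - real_vec l" l] by simp
  moreover have "x - real_vec l \<in> cbox 0 (\<chi> i. 1)"
    by (auto simp: l_def real_vec_def mem_box_cart) linarith
  moreover have "box 0 (\<chi> i. 1) \<noteq> ({} :: (real ^ 'a) set)"
    by (simp add: box_ne_empty Basis_vec_def inner_axis)
  ultimately have "integral unit_cube (\<lambda>y. (norm (?U y))\<^sup>2) \<noteq> 0"
    using integral_cbox_eq_0_iff[OF cont] by (auto simp: unit_cube_def)
  moreover have "integral unit_cube (\<lambda>y. (norm (?U y))\<^sup>2) \<ge> 0"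
    unfolding unit_cube_def
    by (intro Henstock_Kurzweil_Integration.integral_nonneg integrable_continuous cont) auto
  ultimately show ?thesis
    by (simp add: L2_cube_def)
qed

theorem theorem4p7:
  fixes t :: real
  assumes "t > 0"
  shows "\<exists>C1 > 0. \<exists>C2 > 0. \<forall>(C3 :: real) (N :: nat) (f :: real ^ 3 \<Rightarrow> real).
    quadrature_constant C3 \<longrightarrow> N \<ge> 2 \<longrightarrow> periodic f \<longrightarrow> C_class 3 f \<longrightarrow>
    \<not> (\<forall>x. wave_snapshot t f x = 0) \<longrightarrow>
    real N * (L2_cube (wave_snapshot t f))\<^sup>2 \<ge> 4 * C3 * (C_norm 2 (wave_snapshot t f))\<^sup>2 \<longrightarrow>
    (let U = wave_snapshot t f;
         g = discretize N U;
         A = 2 * (norm (integral unit_cube U) / L2_cube U);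
         B = C1 * (C_norm 3 f / L2_cube U);
         C = C2 * (C_norm 3 f / L2_cube U) * (1 / real N);
         r = A + B + C
     in fourier_ratio N g \<le> r)"
proof -
  define W where "W = (\<Sum>\<^sub>\<infinity>k\<in>(UNIV :: (int ^ 3) set). (1 + norm (real_vec k)) powr - 4)"
  have W_summable: "(\<lambda>k :: int ^ 3. (1 + norm (real_vec k)) powr - 4) summable_on UNIV"
    by (rule summable_on_lattice_powr) simp
  have W: "W \<ge> 0"
    unfolding W_def by (rule infsum_nonneg) simp
  \<comment> \<open>\<open>1728 = 2 * 864\<close>; the summand \<open>1\<close> only makes the constant visibly positive\<close>
  define C1 where "C1 = 1728 * (1 + t) * W + 1"
  have main: "fourier_ratio N (discretize N (wave_snapshot t f))
      \<le> 2 * (norm (integral unit_cube (wave_snapshot t f)) / L2_cube (wave_snapshot t f))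
        + C1 * (C_norm 3 f / L2_cube (wave_snapshot t f))
        + 1 * (C_norm 3 f / L2_cube (wave_snapshot t f)) * (1 / real N)"
    if C3: "quadrature_constant C3" and N: "N \<ge> 2" and f: "periodic f" "C_class 3 f"
      and nz: "\<not> (\<forall>x. wave_snapshot t f x = 0)"
      and large: "real N * (L2_cube (wave_snapshot t f))\<^sup>2 \<ge> 4 * C3 * (C_norm 2 (wave_snapshot t f))\<^sup>2"
    for C3 N and f :: "real ^ 3 \<Rightarrow> real"
  proof -
    let ?b = "wave_coeff t f"
    let ?L = "L2_cube (trig_series ?b)" and ?M = "C_norm 3 f"
    note square = wave_coeff_summable_square[OF assms f]
    have "norm (?b k) \<le> norm (?b k) * (1 + norm (real_vec k)) ^ 2" for k
      using one_le_power[of "1 + norm (real_vec k)" 2] by (simp add: mult_le_cancel_left1)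
    then have summable: "(\<lambda>k. norm (?b k)) summable_on UNIV"
      by (intro summable_on_comparison_test[OF square]) auto
    have L: "?L > 0"
      using nz L2_cube_trig_series_pos[OF summable] by (auto simp: wave_snapshot_eq_trig_series)
    have M: "?M \<ge> 0"
      using norm_multi_partial_le_C_norm[OF f(2), of "\<lambda>_. 0" 0]
      by (auto simp: unit_cube_def mem_box_cart intro: order_trans[OF norm_ge_zero])
    have "\<bar>(\<Sum>x\<in>ZN N. (norm (discretize N (trig_series ?b) x))\<^sup>2) / real N ^ 3
          - integral unit_cube (\<lambda>u. (norm (trig_series ?b u))\<^sup>2)\<bar>
        \<le> C3 / real N * (C_norm 2 (trig_series ?b))\<^sup>2"
      using C3 N periodic_trig_series C_class_trig_series[OF square]
      unfolding quadrature_constant_def by blast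
    moreover have "integral unit_cube (\<lambda>u. (norm (trig_series ?b u))\<^sup>2) = ?L\<^sup>2"
      using L by (simp add: L2_cube_def)
    \<comment> \<open>the hypothesis on \<open>N\<close> makes the quadrature error at most a quarter of the integral\<close>
    moreover have "C3 / real N * (C_norm 2 (trig_series ?b))\<^sup>2 \<le> ?L\<^sup>2 / 4"
      using large N by (simp add: wave_snapshot_eq_trig_series field_simps)
    ultimately have "(?L / 2)\<^sup>2 \<le> (\<Sum>x\<in>ZN N. (norm (discretize N (trig_series ?b) x))\<^sup>2) / real N ^ 3"
      using zero_le_power2[of ?L] by (simp add: power_divide)
    then have "real N ^ CARD(3) * (?L / 2)\<^sup>2 \<le> (\<Sum>x\<in>ZN N. (norm (discretize N (trig_series ?b) x))\<^sup>2)"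
      using N by (simp add: pos_le_divide_eq mult.commute)
    then have "fourier_ratio N (discretize N (trig_series ?b)) \<le> 2 * (\<Sum>\<^sub>\<infinity>k\<in>UNIV. norm (?b k)) / ?L"
      using N L summable by (intro fourier_ratio_trig_series_le) auto
    also have "(\<Sum>\<^sub>\<infinity>k\<in>UNIV. norm (?b k)) \<le> 864 * (1 + t) * ?M * W"
      unfolding W_def using summable norm_wave_coeff_le_C_norm[OF assms f] W_summable
      by (subst infsum_cmult_right[symmetric]) (auto intro!: infsum_mono summable_on_cmult_right)
    then have "2 * (\<Sum>\<^sub>\<infinity>k\<in>UNIV. norm (?b k)) / ?L \<le> 2 * (864 * (1 + t) * ?M * W) / ?L"
      using L by (intro divide_right_mono mult_left_mono) auto
    also have "\<dots> \<le> C1 * (?M / ?L)"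
      using L M by (simp add: C1_def field_simps)
    also have "\<dots> \<le> 2 * (norm (integral unit_cube (trig_series ?b)) / ?L) + C1 * (?M / ?L)
        + 1 * (?M / ?L) * (1 / real N)"
      using L M by simp
    finally show ?thesis
      by (simp only: wave_snapshot_eq_trig_series)
  qed
  have "C1 > 0"
    using W assms by (simp add: C1_def add_nonneg_pos)
  then show ?thesis
    unfolding Let_def using main by (intro exI[of _ C1] exI[of _ 1] conjI allI impI) auto
qed

end
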